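(* Let ${\bf A}$ be an Artin group with standard generating set ${\bf S}$, and let $(W,S)$ be the corresponding Coxeter system. Then the involutory quandle of the Artin quandle is the corresponding Coxeter quandle, i.e., there is an isomorphism of quandles $(\mathcal{D}({\bf S}^{{\bf A}}))_2 \cong \mathcal{D}(S^W)$.
   Context: An Artin group is a group with a presentation ${\bf A}=\langle {\bf s}_1,\ldots,{\bf s}_n \mid ({\bf s}_i{\bf s}_j)_{m_{ij}}=({\bf s}_j{\bf s}_i)_{m_{ij}}\rangle$, where $m_{ij}=m_{ji}\in\{2,3,\ldots\}\cup\{\infty\}$ for $i\ne j$, $({\bf s}_i{\bf s}_j)_{m}$ denotes the alternating word ${\bf s}_i{\bf s}_j{\bf s}_i\cdots$ of length $m$, and there is no relation when $m_{ij}=\infty$. Put ${\bf S}=\{{\bf s}_1,\ldots,{\bf s}_n\}$. The corresponding Coxeter group $W$ is the quotient of ${\bf A}$ by the additional relations ${\bf s}_i^2=1$ for all $i$; its generators (images of the ${\bf s}_i$) are written $s_1,\ldots,s_n$ and $S=\{s_1,\ldots,s_n\}$. A quandle is a non-empty set $Q$ with a binary operation $*$ such that: $x*x=x$ for all $x$; for all $x,y$ there is a unique $z$ with $x=z*y$; and $(x*y)*z=(x*z)*(y*z)$ for all $x,y,z$. For a group $G$ and a non-empty subset $A\subseteq G$, the Dehn quandle $\mathcal{D}(A^G)$ is the set $A^G$ of all conjugates in $G$ of elements of $A$, with operation $x*y=yxy^{-1}$. The quandles $\mathcal{D}({\bf S}^{{\bf A}})$ and $\mathcal{D}(S^W)$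 are called the Artin quandle and the Coxeter quandle. For a quandle $Q$, the 2-quandle (involutory quandle) $(Q)_2$ of $Q$ is the quotient of $Q$ by the relations $(x*y)*y=x$ for all $x,y\in Q$. *)

theory Defs
  imports "HOL-Algebra.Generated_Groups" "HOL-Library.Extended_Nat"
begin

section \<open>Groups given by generators and relations\<close>

text \<open>
  Group words over \<open>I\<close> are lists of letters \<open>(i, b)\<close> with \<open>i \<in> I\<close>; the letter \<open>(i, True)\<close> is the
  generator \<open>i\<close> and \<open>(i, False)\<close> its formal inverse. Elements of the free group are words modulo
  free cancellation.
\<close>

inductive_set free_cong :: "'i set \<Rightarrow> (('i \<times> bool) list \<times> ('i \<times> bool) list) set"
  for I :: "'i set" where
  cancel: "\<lbrakk>u \<in> lists (I \<times> UNIV); v \<in> lists (I \<times> UNIV); i \<in> I\<rbrakk>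
     \<Longrightarrow> (u @ [(i, b), (i, \<not> b)] @ v, u @ v) \<in> free_cong I"
| refl: "u \<in> lists (I \<times> UNIV) \<Longrightarrow> (u, u) \<in> free_cong I"
| sym: "(u, v) \<in> free_cong I \<Longrightarrow> (v, u) \<in> free_cong I"
| trans: "\<lbrakk>(u, v) \<in> free_cong I; (v, w) \<in> free_cong I\<rbrakk> \<Longrightarrow> (u, w) \<in> free_cong I"

definition free_group :: "'i set \<Rightarrow> ('i \<times> bool) list set monoid" where
  "free_group I =
     \<lparr>carrier = lists (I \<times> UNIV) // free_cong I,
      mult = (\<lambda>X Y. \<Union>u\<in>X. \<Union>v\<in>Y. free_cong I `` {u @ v}),
      one = free_cong I `` {[]}\<rparr>"

definition free_gen :: "'i set \<Rightarrow> 'i \<Rightarrow> ('i \<times> bool) list set" where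
  "free_gen I i = free_cong I `` {[(i, True)]}"

definition normal_closure :: "('a, 'm) monoid_scheme \<Rightarrow> 'a set \<Rightarrow> 'a set" where
  "normal_closure G X =
     generate G {g \<otimes>\<^bsub>G\<^esub> x \<otimes>\<^bsub>G\<^esub> inv\<^bsub>G\<^esub> g | g x. g \<in> carrier G \<and> x \<in> X}"

text \<open>Relations \<open>u = v\<close> between elements of a group are represented by the pairs \<open>(u, v)\<close>.\<close>

definition rel_normal :: "('a, 'm) monoid_scheme \<Rightarrow> ('a \<times> 'a) set \<Rightarrow> 'a set" where
  "rel_normal G R = normal_closure G {u \<otimes>\<^bsub>G\<^esub> inv\<^bsub>G\<^esub> v | u v. (u, v) \<in> R}"

definition group_quot :: "('a, 'm) monoid_scheme \<Rightarrow> ('a \<times> 'a) set \<Rightarrow> 'a set monoid" where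
  "group_quot G R = G Mod rel_normal G R"

definition group_quot_proj :: "('a, 'm) monoid_scheme \<Rightarrow> ('a \<times> 'a) set \<Rightarrow> 'a \<Rightarrow> 'a set" where
  "group_quot_proj G R x = rel_normal G R #>\<^bsub>G\<^esub> x"

text \<open>
  The group \<open>G\<close> with the family \<open>s\<close>, indexed by \<open>I\<close>, has the presentation \<open>\<langle>I | R\<rangle>\<close>, where \<open>R\<close>
  consists of relations between elements of the free group on \<open>I\<close>.
\<close>

definition has_presentation ::
  "('a, 'm) monoid_scheme \<Rightarrow> 'i set \<Rightarrow> ('i \<Rightarrow> 'a)
     \<Rightarrow> (('i \<times> bool) list set \<times> ('i \<times> bool) list set) set \<Rightarrow> bool" where
  "has_presentation G I s R \<longleftrightarrow>
     group G \<and>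
     (\<exists>\<phi> \<in> iso (group_quot (free_group I) R) G.
        \<forall>i\<in>I. \<phi> (group_quot_proj (free_group I) R (free_gen I i)) = s i)"


section \<open>Artin groups and Coxeter groups\<close>

text \<open>The alternating product \<open>x y x \<dots>\<close> with \<open>k\<close> factors.\<close>

primrec alternating :: "('a, 'm) monoid_scheme \<Rightarrow> 'a \<Rightarrow> 'a \<Rightarrow> nat \<Rightarrow> 'a" where
  "alternating G x y 0 = \<one>\<^bsub>G\<^esub>"
| "alternating G x y (Suc k) = x \<otimes>\<^bsub>G\<^esub> alternating G y x k"

text \<open>Only the off-diagonal entries of \<open>m\<close> are relevant.\<close>

definition artin_matrix :: "nat \<Rightarrow> (nat \<Rightarrow> nat \<Rightarrow> enat) \<Rightarrow> bool" where
  "artin_matrix n m \<longleftrightarrow>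
     (\<forall>i\<in>{1..n}. \<forall>j\<in>{1..n}. i \<noteq> j \<longrightarrow> m i j = m j i \<and> 2 \<le> m i j)"

definition artin_relations ::
  "nat \<Rightarrow> (nat \<Rightarrow> nat \<Rightarrow> enat)
     \<Rightarrow> ((nat \<times> bool) list set \<times> (nat \<times> bool) list set) set" where
  "artin_relations n m =
     {(alternating F (free_gen {1..n} i) (free_gen {1..n} j) k,
       alternating F (free_gen {1..n} j) (free_gen {1..n} i) k) | F i j k.
        F = free_group {1..n} \<and> i \<in> {1..n} \<and> j \<in> {1..n} \<and> i \<noteq> j \<and> m i j = enat k}"

definition artin_group ::
  "('a, 'm) monoid_scheme \<Rightarrow> nat \<Rightarrow> (nat \<Rightarrow> nat \<Rightarrow> enat) \<Rightarrow> (nat \<Rightarrow> 'a) \<Rightarrow> bool" where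
  "artin_group A n m s \<longleftrightarrow>
     artin_matrix n m \<and> has_presentation A {1..n} s (artin_relations n m)"

definition coxeter_relations ::
  "('a, 'm) monoid_scheme \<Rightarrow> nat \<Rightarrow> (nat \<Rightarrow> 'a) \<Rightarrow> ('a \<times> 'a) set" where
  "coxeter_relations A n s = {(s i \<otimes>\<^bsub>A\<^esub> s i, \<one>\<^bsub>A\<^esub>) | i. i \<in> {1..n}}"

definition coxeter_group ::
  "('a, 'm) monoid_scheme \<Rightarrow> nat \<Rightarrow> (nat \<Rightarrow> 'a) \<Rightarrow> 'a set monoid" where
  "coxeter_group A n s = group_quot A (coxeter_relations A n s)"

definition coxeter_gen ::
  "('a, 'm) monoid_scheme \<Rightarrow> nat \<Rightarrow> (nat \<Rightarrow> 'a) \<Rightarrow> nat \<Rightarrow> 'a set" where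
  "coxeter_gen A n s i = group_quot_proj A (coxeter_relations A n s) (s i)"


section \<open>Quandles\<close>

record 'a quandle_struct = "'a partial_object" +
  qop :: "'a \<Rightarrow> 'a \<Rightarrow> 'a" (infixl \<open>\<star>\<index>\<close> 70)

locale quandle =
  fixes Q :: "('a, 'm) quandle_struct_scheme" (structure)
  assumes nonempty: "carrier Q \<noteq> {}"
    and closed: "\<lbrakk>x \<in> carrier Q; y \<in> carrier Q\<rbrakk> \<Longrightarrow> x \<star> y \<in> carrier Q"
    and idem: "x \<in> carrier Q \<Longrightarrow> x \<star> x = x"
    and right_div: "\<lbrakk>x \<in> carrier Q; y \<in> carrier Q\<rbrakk> \<Longrightarrow> \<exists>!z. z \<in> carrier Q \<and> x = z \<star> y"
    and distrib: "\<lbrakk>x \<in> carrier Q; y \<in> carrier Q; z \<in> carrier Q\<rbrakk>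
      \<Longrightarrow> (x \<star> y) \<star> z = (x \<star> z) \<star> (y \<star> z)"

definition quandle_hom ::
  "('a, 'm) quandle_struct_scheme \<Rightarrow> ('b, 'k) quandle_struct_scheme \<Rightarrow> ('a \<Rightarrow> 'b) set" where
  "quandle_hom P Q = {f \<in> carrier P \<rightarrow> carrier Q.
     \<forall>x\<in>carrier P. \<forall>y\<in>carrier P. f (x \<star>\<^bsub>P\<^esub> y) = f x \<star>\<^bsub>Q\<^esub> f y}"

definition quandle_iso ::
  "('a, 'm) quandle_struct_scheme \<Rightarrow> ('b, 'k) quandle_struct_scheme \<Rightarrow> ('a \<Rightarrow> 'b) set" where
  "quandle_iso P Q = {f \<in> quandle_hom P Q. bij_betw f (carrier P) (carrier Q)}"

definition quandle_isomorphic ::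
  "('a, 'm) quandle_struct_scheme \<Rightarrow> ('b, 'k) quandle_struct_scheme \<Rightarrow> bool" where
  "quandle_isomorphic P Q \<longleftrightarrow> quandle P \<and> quandle Q \<and> quandle_iso P Q \<noteq> {}"

text \<open>The Dehn quandle \<open>\<D>(A\<^sup>G)\<close>.\<close>

definition dehn_quandle :: "('a, 'm) monoid_scheme \<Rightarrow> 'a set \<Rightarrow> 'a quandle_struct" where
  "dehn_quandle G A =
     \<lparr>carrier = {g \<otimes>\<^bsub>G\<^esub> a \<otimes>\<^bsub>G\<^esub> inv\<^bsub>G\<^esub> g | g a. g \<in> carrier G \<and> a \<in> A},
      qop = (\<lambda>x y. y \<otimes>\<^bsub>G\<^esub> x \<otimes>\<^bsub>G\<^esub> inv\<^bsub>G\<^esub> y)\<rparr>"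

text \<open>
  The quandle congruence on \<open>Q\<close> generated by a set \<open>R\<close> of relations. Rule \<open>cancel\<close> expresses
  compatibility with the right division operation of \<open>Q\<close>; it is needed for the quotient to
  satisfy the axiom of unique right division.
\<close>

inductive_set quandle_cong ::
  "('a, 'm) quandle_struct_scheme \<Rightarrow> ('a \<times> 'a) set \<Rightarrow> ('a \<times> 'a) set"
  for Q :: "('a, 'm) quandle_struct_scheme" and R :: "('a \<times> 'a) set" where
  base: "\<lbrakk>(x, y) \<in> R; x \<in> carrier Q; y \<in> carrier Q\<rbrakk> \<Longrightarrow> (x, y) \<in> quandle_cong Q R"
| refl: "x \<in> carrier Q \<Longrightarrow> (x, x) \<in> quandle_cong Q R"
| sym: "(x, y) \<in> quandle_cong Q R \<Longrightarrow> (y, x) \<in> quandle_cong Q R"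
| trans: "\<lbrakk>(x, y) \<in> quandle_cong Q R; (y, z) \<in> quandle_cong Q R\<rbrakk>
    \<Longrightarrow> (x, z) \<in> quandle_cong Q R"
| op: "\<lbrakk>(x, x') \<in> quandle_cong Q R; (y, y') \<in> quandle_cong Q R\<rbrakk>
    \<Longrightarrow> (x \<star>\<^bsub>Q\<^esub> y, x' \<star>\<^bsub>Q\<^esub> y') \<in> quandle_cong Q R"
| cancel: "\<lbrakk>(x \<star>\<^bsub>Q\<^esub> y, x' \<star>\<^bsub>Q\<^esub> y') \<in> quandle_cong Q R; (y, y') \<in> quandle_cong Q R;
     x \<in> carrier Q; x' \<in> carrier Q\<rbrakk> \<Longrightarrow> (x, x') \<in> quandle_cong Q R"

definition quandle_quot ::
  "('a, 'm) quandle_struct_scheme \<Rightarrow> ('a \<times> 'a) set \<Rightarrow> 'a set quandle_struct" where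
  "quandle_quot Q R =
     \<lparr>carrier = carrier Q // quandle_cong Q R,
      qop = (\<lambda>X Y. \<Union>x\<in>X. \<Union>y\<in>Y. quandle_cong Q R `` {x \<star>\<^bsub>Q\<^esub> y})\<rparr>"

text \<open>The involutory quandle \<open>(Q)\<^sub>2\<close> of \<open>Q\<close>.\<close>

definition involutory_quandle ::
  "('a, 'm) quandle_struct_scheme \<Rightarrow> 'a set quandle_struct" where
  "involutory_quandle Q =
     quandle_quot Q
       {((x \<star>\<^bsub>Q\<^esub> y) \<star>\<^bsub>Q\<^esub> y, x) | x y. x \<in> carrier Q \<and> y \<in> carrier Q}"

end

theory Submission
  imports Defs "HOL-Library.Z2"
begin

text \<open>
  Let \<open>N\<close> be the normal closure of the squares \<open>s\<^sub>i\<^sup>2\<close> in the Artin group \<open>A\<close>, so that \<open>W = A / N\<close>,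
  and let \<open>X\<close> be the Artin quandle. The projection \<open>\<pi>\<close> maps \<open>X\<close> onto the Coxeter quandle, and since
  reflections square to 1 in \<open>W\<close> it identifies elements that are congruent (\<open>\<approx>\<close>) in the
  involutory quandle. By \<open>quandle_quot_isomorphic\<close> it remains to show the converse: if \<open>x\<close> and \<open>y\<close>
  in \<open>X\<close> have the same image in \<open>W\<close>, then \<open>x \<approx> y\<close>.

  Conjugation by the square of an element of \<open>X\<close> does not change classes, so \<open>N\<close> acts trivially on
  the set \<open>Q\<close> of classes and \<open>W\<close> acts on \<open>Q\<close>. The idea is to lift to \<open>Q\<close> the classical device of
  counting, modulo 2, the reflections met along a word. Attach to a word \<open>s\<^sub>1 \<dots> s\<^sub>r\<close> the classes of
  \<open>p\<^sub>l s\<^sub>l\<^sub>+\<^sub>1 p\<^sub>l\<inverse>\<close>, where \<open>p\<^sub>l = s\<^sub>1 \<dots> s\<^sub>l\<close>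
  (an inverse letter counts like the generator that it inverts). The two sides of a braid relation give the same classes in
  opposite order (\<open>dihedral_reflection_palindrome\<close>). Therefore the parity \<open>c g x\<close> with which the
  class of \<open>x\<close> occurs depends on the element \<open>g\<close> of \<open>A\<close> alone
  (\<open>artin_reflection_cocycle\<close>), it satisfies \<open>c (g h) x = c g x + c h (g\<inverse> x g)\<close>, and it vanishes
  for \<open>g\<close> in \<open>N\<close> (\<open>c_square_closure\<close>).

  For \<open>x\<close> and \<open>y\<close> in \<open>X\<close> such that conjugation by \<open>x\<close> fixes the class of \<open>y\<close>, expanding \<open>x = w s w\<inverse>\<close>
  shows that \<open>c x y = 1\<close> if and only if \<open>y \<approx> x\<close> (\<open>c_reflection\<close>): the contributions of \<open>w\<close> and
  \<open>w\<inverse>\<close> cancel. In particular \<open>c y y = 1\<close>. If now \<open>x\<close> and \<open>y\<close> agree modulo \<open>N\<close>, then \<open>x\<close> acts on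
  \<open>Q\<close> as \<open>y\<close> does and so fixes the class of \<open>y\<close>, and \<open>c x y = c y y = 1\<close>; hence \<open>y \<approx> x\<close>
  (\<open>invol_cong_if_coset_eq\<close>).
\<close>

section \<open>Free groups\<close>

lemma free_cong_words:
  assumes "(u, v) \<in> free_cong I"
  shows "u \<in> lists (I \<times> UNIV) \<and> v \<in> lists (I \<times> UNIV)"
  using assms by (induction rule: free_cong.induct) auto

lemma equiv_free_cong: "equiv (lists (I \<times> UNIV)) (free_cong I)"
  by (rule equivI) (auto intro: refl_onI symI transI free_cong.refl free_cong.sym free_cong.trans
      dest: free_cong_words)

lemma free_cong_context:
  assumes "(u, v) \<in> free_cong I" "p \<in> lists (I \<times> UNIV)" "q \<in> lists (I \<times> UNIV)"
  shows "(p @ u @ q, p @ v @ q) \<in> free_cong I"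
  using assms
proof (induction rule: free_cong.induct)
  case (cancel u v i b)
  then show ?case
    using free_cong.cancel[of "p @ u" I "v @ q" i b] by auto
next
  case (refl u)
  then show ?case by (intro free_cong.refl) simp
qed (blast intro: free_cong.sym free_cong.trans)+

lemma free_cong_append:
  assumes "(u, u') \<in> free_cong I" "(v, v') \<in> free_cong I"
  shows "(u @ v, u' @ v') \<in> free_cong I"
  using free_cong_context[OF assms(1), of "[]" v] free_cong_context[OF assms(2), of u' "[]"]
    free_cong_words[OF assms(1)] free_cong_words[OF assms(2)]
  by (auto intro: free_cong.trans)

lemma free_group_mult:
  assumes "u \<in> lists (I \<times> UNIV)" "v \<in> lists (I \<times> UNIV)"
  shows "free_cong I `` {u} \<otimes>\<^bsub>free_group I\<^esub> free_cong I `` {v} = free_cong I `` {u @ v}"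
proof -
  have "congruent2 (free_cong I) (free_cong I) (\<lambda>u v. free_cong I `` {u @ v})"
    by (rule congruent2I') (rule equiv_class_eq[OF equiv_free_cong free_cong_append])
  from UN_equiv_class2[OF equiv_free_cong equiv_free_cong this assms] show ?thesis
    by (simp add: free_group_def)
qed

lemma free_group_carrierE:
  assumes "X \<in> carrier (free_group I)"
  obtains u where "u \<in> lists (I \<times> UNIV)" "X = free_cong I `` {u}"
  using assms that by (auto simp only: free_group_def partial_object.simps elim!: quotientE)

lemma free_class_closed:
  "u \<in> lists (I \<times> UNIV) \<Longrightarrow> free_cong I `` {u} \<in> carrier (free_group I)"
  by (auto simp: free_group_def intro: quotientI)

lemma free_group_one: "\<one>\<^bsub>free_group I\<^esub> = free_cong I `` {[]}"
  by (simp add: free_group_def)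

lemma free_gen_closed: "i \<in> I \<Longrightarrow> free_gen I i \<in> carrier (free_group I)"
  by (simp add: free_gen_def free_class_closed)

definition formal_inverse :: "('i \<times> bool) list \<Rightarrow> ('i \<times> bool) list" where
  "formal_inverse u = rev (map (\<lambda>(i, b). (i, \<not> b)) u)"

lemma formal_inverse_words:
  "u \<in> lists (I \<times> UNIV) \<Longrightarrow> formal_inverse u \<in> lists (I \<times> UNIV)"
  by (auto simp: formal_inverse_def in_lists_conv_set)

lemma formal_inverse_cancel:
  assumes "u \<in> lists (I \<times> UNIV)"
  shows "(formal_inverse u @ u, []) \<in> free_cong I"
  using assms
proof (induction u)
  case (Cons a u)
  obtain i b where a: "a = (i, b)" "i \<in> I" using Cons.hyps by auto
  have "(formal_inverse u @ [(i, \<not> b), (i, \<not> \<not> b)] @ u, formal_inverse u @ u) \<in> free_cong I"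
    using Cons.hyps a by (intro free_cong.cancel formal_inverse_words) auto
  then show ?case
    using Cons.IH by (auto simp: a formal_inverse_def intro: free_cong.trans)
qed (auto simp: formal_inverse_def intro: free_cong.refl)

lemma group_free_group: "group (free_group I)"
proof (rule groupI)
  fix X Y Z
  assume X: "X \<in> carrier (free_group I)"
  obtain u where u: "u \<in> lists (I \<times> UNIV)" "X = free_cong I `` {u}"
    using X by (rule free_group_carrierE)
  show "\<one>\<^bsub>free_group I\<^esub> \<otimes>\<^bsub>free_group I\<^esub> X = X"
    using u by (simp add: free_group_one free_group_mult)
  have "free_cong I `` {formal_inverse u} \<otimes>\<^bsub>free_group I\<^esub> X = \<one>\<^bsub>free_group I\<^esub>"
    unfolding u(2) free_group_mult[OF formal_inverse_words[OF u(1)] u(1)] free_group_one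
    by (rule equiv_class_eq[OF equiv_free_cong formal_inverse_cancel[OF u(1)]])
  then show "\<exists>Y\<in>carrier (free_group I). Y \<otimes>\<^bsub>free_group I\<^esub> X = \<one>\<^bsub>free_group I\<^esub>"
    using free_class_closed[OF formal_inverse_words[OF u(1)]] by blast
  assume Y: "Y \<in> carrier (free_group I)"
  obtain v where v: "v \<in> lists (I \<times> UNIV)" "Y = free_cong I `` {v}"
    using Y by (rule free_group_carrierE)
  have uv: "u @ v \<in> lists (I \<times> UNIV)" using u v by simp
  show "X \<otimes>\<^bsub>free_group I\<^esub> Y \<in> carrier (free_group I)"
    using u v free_class_closed[OF uv] by (simp add: free_group_mult)
  assume Z: "Z \<in> carrier (free_group I)"
  obtain w where w: "w \<in> lists (I \<times> UNIV)" "Z = free_cong I `` {w}"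
    using Z by (rule free_group_carrierE)
  have vw: "v @ w \<in> lists (I \<times> UNIV)" using v w by simp
  show "X \<otimes>\<^bsub>free_group I\<^esub> Y \<otimes>\<^bsub>free_group I\<^esub> Z = X \<otimes>\<^bsub>free_group I\<^esub> (Y \<otimes>\<^bsub>free_group I\<^esub> Z)"
    using u v w free_group_mult[OF uv w(1)] free_group_mult[OF u(1) vw]
    by (simp add: free_group_mult)
qed (simp add: free_group_one free_class_closed)

primrec word_value ::
  "('a, 'm) monoid_scheme \<Rightarrow> ('i \<Rightarrow> 'a) \<Rightarrow> ('i \<times> bool) list \<Rightarrow> 'a" where
  "word_value H h [] = \<one>\<^bsub>H\<^esub>"
| "word_value H h (a # u) =
     (if snd a then h (fst a) else inv\<^bsub>H\<^esub> h (fst a)) \<otimes>\<^bsub>H\<^esub> word_value H h u"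

lemma (in group) word_value_closed:
  assumes "h \<in> I \<rightarrow> carrier G" "u \<in> lists (I \<times> UNIV)"
  shows "word_value G h u \<in> carrier G"
  using assms(2,1) by (induction u) (auto simp: Pi_iff)

lemma (in group) word_value_append:
  assumes "h \<in> I \<rightarrow> carrier G" "u \<in> lists (I \<times> UNIV)" "v \<in> lists (I \<times> UNIV)"
  shows "word_value G h (u @ v) = word_value G h u \<otimes> word_value G h v"
  using assms(2)
proof (induction u)
  case (Cons a u)
  then show ?case
    using word_value_closed[OF assms(1) Cons.hyps(2)] word_value_closed[OF assms(1,3)] assms(1)
    by (auto simp: m_assoc Pi_iff)
qed (use word_value_closed[OF assms(1,3)] in simp)

lemma (in group) word_value_cong:
  assumes "h \<in> I \<rightarrow> carrier G" "(u, v) \<in> free_cong I"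
  shows "word_value G h u = word_value G h v"
  using assms(2)
proof (induction rule: free_cong.induct)
  case (cancel u v i b)
  have i: "h i \<in> carrier G" and v: "word_value G h v \<in> carrier G"
    using assms(1) cancel word_value_closed by auto
  have "word_value G h ([(i, b), (i, \<not> b)] @ v) = word_value G h v"
    using i v by (cases b) (simp_all flip: m_assoc)
  moreover have "[(i, b), (i, \<not> b)] @ v \<in> lists (I \<times> UNIV)"
    using cancel by auto
  ultimately show ?case
    using word_value_append[OF assms(1) cancel(1), of "[(i, b), (i, \<not> b)] @ v"]
      word_value_append[OF assms(1) cancel(1,2)] by simp
qed auto

lemma free_group_hom_extension:
  assumes "group H" "h \<in> I \<rightarrow> carrier H"
  obtains \<psi> where "\<psi> \<in> hom (free_group I) H" "\<And>i. i \<in> I \<Longrightarrow> \<psi> (free_gen I i) = h i"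
proof -
  interpret group H by fact
  define \<psi> where "\<psi> X = the_elem (word_value H h ` X)" for X
  have \<psi>: "\<psi> (free_cong I `` {u}) = word_value H h u" if "u \<in> lists (I \<times> UNIV)" for u
    unfolding \<psi>_def
  proof (rule the_elem_image_unique)
    show "free_cong I `` {u} \<noteq> {}"
      using free_cong.refl[OF that] by blast
    show "word_value H h v = word_value H h u" if "v \<in> free_cong I `` {u}" for v
      using word_value_cong[OF assms(2), of u v] that by simp
  qed
  show thesis
  proof
    show "\<psi> \<in> hom (free_group I) H"
    proof (rule homI)
      fix X Y assume XY: "X \<in> carrier (free_group I)" "Y \<in> carrier (free_group I)"
      obtain u where u: "u \<in> lists (I \<times> UNIV)" "X = free_cong I `` {u}"
        using XY(1) by (rule free_group_carrierE)
      obtain v where v: "v \<in> lists (I \<times> UNIV)" "Y = free_cong I `` {v}"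
        using XY(2) by (rule free_group_carrierE)
      show "\<psi> X \<in> carrier H"
        using u \<psi> word_value_closed[OF assms(2)] by simp
      have "u @ v \<in> lists (I \<times> UNIV)" using u v by simp
      from \<psi>[OF this] show "\<psi> (X \<otimes>\<^bsub>free_group I\<^esub> Y) = \<psi> X \<otimes>\<^bsub>H\<^esub> \<psi> Y"
        using u v \<psi> word_value_append[OF assms(2)] by (simp add: free_group_mult)
    qed
    show "\<psi> (free_gen I i) = h i" if "i \<in> I" for i
      using that \<psi>[of "[(i, True)]"] assms(2) by (auto simp: free_gen_def Pi_iff)
  qed
qed

section \<open>Groups given by a presentation\<close>

lemma (in group) conjugates_closed:
  assumes "X \<subseteq> carrier G"
  shows "{g \<otimes> x \<otimes> inv g | g x. g \<in> carrier G \<and> x \<in> X} \<subseteq> carrier G"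
  using assms by auto

lemma (in group) normal_normal_closure:
  assumes "X \<subseteq> carrier G"
  shows "normal_closure G X \<lhd> G"
  unfolding normal_closure_def
proof (rule normal_generateI)
  fix h g assume h: "h \<in> {g \<otimes> x \<otimes> inv g | g x. g \<in> carrier G \<and> x \<in> X}" and g: "g \<in> carrier G"
  then obtain k x where kx: "k \<in> carrier G" "x \<in> X" "h = k \<otimes> x \<otimes> inv k"
    by auto
  moreover have "g \<otimes> h \<otimes> inv g = (g \<otimes> k) \<otimes> x \<otimes> inv (g \<otimes> k)"
    using kx g assms by (auto simp: m_assoc inv_mult_group subset_iff)
  ultimately show "g \<otimes> h \<otimes> inv g \<in> {g \<otimes> x \<otimes> inv g | g x. g \<in> carrier G \<and> x \<in> X}"
    using g by blast
qed (rule conjugates_closed[OF assms])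

lemma (in group) normal_closure_incl:
  assumes "x \<in> X" "X \<subseteq> carrier G"
  shows "x \<in> normal_closure G X"
proof -
  have "x = \<one> \<otimes> x \<otimes> inv \<one>" using assms by auto
  then show ?thesis
    unfolding normal_closure_def using assms by (intro generate.incl) blast
qed

lemma (in group) normal_closure_least:
  assumes "N \<lhd> G" "X \<subseteq> N"
  shows "normal_closure G X \<subseteq> N"
proof -
  interpret N: normal N G by fact
  show ?thesis
    unfolding normal_closure_def
    using assms(2) N.inv_op_closed2 by (intro generate_subgroup_incl N.is_subgroup) auto
qed

lemma (in group) relators_closed:
  assumes "R \<subseteq> carrier G \<times> carrier G"
  shows "{u \<otimes> inv v | u v. (u, v) \<in> R} \<subseteq> carrier G"
  using assms by auto

lemma (in group) normal_rel_normal: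
  "R \<subseteq> carrier G \<times> carrier G \<Longrightarrow> rel_normal G R \<lhd> G"
  unfolding rel_normal_def by (intro normal_normal_closure relators_closed)

lemma (in group_hom) rel_normal_kernel:
  assumes "R \<subseteq> carrier G \<times> carrier G" "\<And>u v. (u, v) \<in> R \<Longrightarrow> h u = h v"
  shows "rel_normal G R \<subseteq> kernel G H h"
  unfolding rel_normal_def
proof (rule G.normal_closure_least[OF normal_kernel])
  show "{u \<otimes>\<^bsub>G\<^esub> inv\<^bsub>G\<^esub> v | u v. (u, v) \<in> R} \<subseteq> kernel G H h"
    using assms by (auto simp: kernel_def)
qed

lemma (in group) group_quot_proj_hom:
  assumes "R \<subseteq> carrier G \<times> carrier G"
  shows "group (group_quot G R)" "group_quot_proj G R \<in> hom G (group_quot G R)"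
    and "group_quot_proj G R ` carrier G = carrier (group_quot G R)"
    and "\<And>u v. (u, v) \<in> R \<Longrightarrow> group_quot_proj G R u = group_quot_proj G R v"
proof -
  interpret N: normal "rel_normal G R" G by (rule normal_rel_normal[OF assms])
  show "group (group_quot G R)"
    by (simp add: group_quot_def N.factorgroup_is_group)
  show "group_quot_proj G R \<in> hom G (group_quot G R)"
    using N.r_coset_hom_Mod by (simp add: group_quot_def group_quot_proj_def[abs_def])
  show "group_quot_proj G R ` carrier G = carrier (group_quot G R)"
    by (auto simp: group_quot_def group_quot_proj_def FactGroup_def RCOSETS_def)
  fix u v assume uv: "(u, v) \<in> R"
  then have c: "u \<in> carrier G" "v \<in> carrier G" using assms by auto
  have "u \<otimes> inv v \<in> rel_normal G R"
    unfolding rel_normal_def using uv by (intro normal_closure_incl relators_closed assms) auto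
  then have "u \<in> rel_normal G R #> v"
    using N.rcos_module_rev[OF is_group c(2) c(1)] by simp
  then show "group_quot_proj G R u = group_quot_proj G R v"
    unfolding group_quot_proj_def using repr_independence[OF _ c(2) N.is_subgroup] by simp
qed

text \<open>
  The canonical map from the free group onto a presented group, composed of the projection to the
  quotient by the relators and the isomorphism that the presentation provides.
\<close>

lemma has_presentation_hom:
  assumes "has_presentation G I s R" "R \<subseteq> carrier (free_group I) \<times> carrier (free_group I)"
  obtains \<theta> where "\<theta> \<in> hom (free_group I) G" "\<theta> ` carrier (free_group I) = carrier G"
    "\<And>i. i \<in> I \<Longrightarrow> \<theta> (free_gen I i) = s i" "\<And>u v. (u, v) \<in> R \<Longrightarrow> \<theta> u = \<theta> v"
proof -
  interpret F: group "free_group I" by (rule group_free_group)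
  note q = F.group_quot_proj_hom[OF assms(2)]
  obtain \<phi> where \<phi>: "\<phi> \<in> iso (group_quot (free_group I) R) G"
    "\<And>i. i \<in> I \<Longrightarrow> \<phi> (group_quot_proj (free_group I) R (free_gen I i)) = s i"
    using assms(1) unfolding has_presentation_def by blast
  show thesis
  proof
    show "\<phi> \<circ> group_quot_proj (free_group I) R \<in> hom (free_group I) G"
      using q(2) \<phi>(1) by (auto intro: hom_compose simp: iso_def)
    show "(\<phi> \<circ> group_quot_proj (free_group I) R) ` carrier (free_group I) = carrier G"
      using q(3) \<phi>(1) by (simp only: image_comp[symmetric]) (simp add: iso_def bij_betw_def)
  qed (use \<phi> q in auto)
qed

lemma has_presentation_generate:
  assumes "has_presentation G I s R" "R \<subseteq> carrier (free_group I) \<times> carrier (free_group I)"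
  shows "carrier G = generate G (s ` I)" "s \<in> I \<rightarrow> carrier G"
proof -
  interpret group G using assms(1) by (simp add: has_presentation_def)
  obtain \<theta> where \<theta>: "\<theta> \<in> hom (free_group I) G" "\<theta> ` carrier (free_group I) = carrier G"
    "\<And>i. i \<in> I \<Longrightarrow> \<theta> (free_gen I i) = s i"
    using has_presentation_hom[OF assms] by metis
  interpret F: group "free_group I" by (rule group_free_group)
  interpret \<theta>: group_hom "free_group I" G \<theta> by unfold_locales (rule \<theta>(1))
  show s: "s \<in> I \<rightarrow> carrier G"
    using \<theta>(3) \<theta>.hom_closed free_gen_closed by (metis Pi_I)
  have gen: "\<theta> (free_cong I `` {u}) \<in> generate G (s ` I)" if "u \<in> lists (I \<times> UNIV)" for u
    using that
  proof (induction u)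
    case Nil
    then show ?case using \<theta>.hom_one generate.one by (metis free_group_one)
  next
    case (Cons a u)
    obtain i b where a: "a = (i, b)" "i \<in> I" using Cons.hyps by auto
    have l: "[(i, c)] \<in> lists (I \<times> UNIV)" for c using a by simp
    note cl = free_class_closed[OF l]
    have "free_cong I `` {[(i, False)]} \<otimes>\<^bsub>free_group I\<^esub> free_gen I i = \<one>\<^bsub>free_group I\<^esub>"
      unfolding free_gen_def free_group_mult[OF l l] free_group_one
      using equiv_class_eq[OF equiv_free_cong formal_inverse_cancel[OF l[of True]]]
      by (simp add: formal_inverse_def)
    then have "free_cong I `` {[(i, False)]} = inv\<^bsub>free_group I\<^esub> free_gen I i"
      using cl F.inv_equality free_gen_closed[OF a(2)] by metis
    then have "\<theta> (free_cong I `` {[a]}) \<in> generate G (s ` I)"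
      using a \<theta>(3) \<theta>.hom_inv[OF free_gen_closed[OF a(2)]]
      by (cases b) (auto simp: free_gen_def intro: generate.incl generate.inv)
    moreover have "free_cong I `` {a # u} = free_cong I `` {[a]} \<otimes>\<^bsub>free_group I\<^esub> free_cong I `` {u}"
      using free_group_mult[OF l Cons.hyps(2)] a by simp
    ultimately show ?case
      using Cons cl[of b] free_class_closed[OF Cons.hyps(2)] generate.eng a by simp
  qed
  show "carrier G = generate G (s ` I)"
  proof
    show "carrier G \<subseteq> generate G (s ` I)"
    proof
      fix x assume "x \<in> carrier G"
      then obtain X where "X \<in> carrier (free_group I)" "x = \<theta> X" using \<theta>(2) by auto
      then show "x \<in> generate G (s ` I)" by (metis gen free_group_carrierE)
    qed
    show "generate G (s ` I) \<subseteq> carrier G"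
      using s by (intro generate_incl) auto
  qed
qed

text \<open>
  The extension of \<open>h\<close> to the free group kills the normal closure of the relators as soon as it
  respects the relations, so it factors through the quotient. The hypothesis on the relations
  speaks of an arbitrary extension \<open>\<psi>\<close>; there is only one, and this form spares naming it.
\<close>

lemma von_Dyck:
  assumes "has_presentation G I s R" "R \<subseteq> carrier (free_group I) \<times> carrier (free_group I)"
    and "group H" "h \<in> I \<rightarrow> carrier H"
    and "\<And>\<psi> u v. \<lbrakk>\<psi> \<in> hom (free_group I) H; \<And>i. i \<in> I \<Longrightarrow> \<psi> (free_gen I i) = h i; (u, v) \<in> R\<rbrakk>
      \<Longrightarrow> \<psi> u = \<psi> v"
  obtains f where "f \<in> hom G H" "\<And>i. i \<in> I \<Longrightarrow> f (s i) = h i"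
proof -
  interpret F: group "free_group I" by (rule group_free_group)
  obtain \<phi> where \<phi>: "\<phi> \<in> iso (group_quot (free_group I) R) G"
    "\<And>i. i \<in> I \<Longrightarrow> \<phi> (group_quot_proj (free_group I) R (free_gen I i)) = s i"
    using assms(1) unfolding has_presentation_def by blast
  obtain \<psi> where \<psi>: "\<psi> \<in> hom (free_group I) H" "\<And>i. i \<in> I \<Longrightarrow> \<psi> (free_gen I i) = h i"
    using free_group_hom_extension[OF assms(3,4)] by metis
  interpret \<psi>: group_hom "free_group I" H \<psi>
    using assms(3) \<psi>(1) by (simp add: group_hom_def group_hom_axioms_def group_free_group)
  have "rel_normal (free_group I) R \<subseteq> kernel (free_group I) H \<psi>"
    by (rule \<psi>.rel_normal_kernel[OF assms(2)]) (rule assms(5)[OF \<psi>])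
  then obtain g where g: "g \<in> hom (group_quot (free_group I) R) H"
    "\<And>x. x \<in> carrier (free_group I) \<Longrightarrow> g (group_quot_proj (free_group I) R x) = \<psi> x"
    unfolding group_quot_def group_quot_proj_def
    using \<psi>.FactGroup_universal_kernel[OF F.normal_rel_normal[OF assms(2)]] by metis
  let ?\<phi>' = "inv_into (carrier (group_quot (free_group I) R)) \<phi>"
  interpret Q: group "group_quot (free_group I) R"
    by (rule F.group_quot_proj_hom(1)[OF assms(2)])
  show thesis
  proof
    show "g \<circ> ?\<phi>' \<in> hom G H"
      using Q.iso_set_sym[OF \<phi>(1)] g(1) by (auto intro: hom_compose simp: iso_def)
    show "(g \<circ> ?\<phi>') (s i) = h i" if i: "i \<in> I" for i
    proof -
      have "group_quot_proj (free_group I) R (free_gen I i) \<in> carrier (group_quot (free_group I) R)"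
        using F.group_quot_proj_hom(3)[OF assms(2)] free_gen_closed[OF i] by blast
      then have "?\<phi>' (s i) = group_quot_proj (free_group I) R (free_gen I i)"
        using \<phi> i by (metis (no_types, lifting) iso_def bij_betw_inv_into_left mem_Collect_eq)
      then show ?thesis using g(2)[OF free_gen_closed[OF i]] \<psi>(2)[OF i] by simp
    qed
  qed
qed

section \<open>Quotients of quandles\<close>

lemma (in quandle) quandle_cong_closed:
  assumes "(x, y) \<in> quandle_cong Q R"
  shows "x \<in> carrier Q \<and> y \<in> carrier Q"
  using assms by (induction rule: quandle_cong.induct) (auto intro: closed)

lemma (in quandle) equiv_quandle_cong: "equiv (carrier Q) (quandle_cong Q R)"
  by (rule equivI) (auto intro: refl_onI symI transI quandle_cong.refl quandle_cong.sym
      quandle_cong.trans dest: quandle_cong_closed)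

lemma (in quandle) quandle_quot_op:
  assumes "x \<in> carrier Q" "y \<in> carrier Q"
  shows "quandle_cong Q R `` {x} \<star>\<^bsub>quandle_quot Q R\<^esub> quandle_cong Q R `` {y}
    = quandle_cong Q R `` {x \<star> y}"
proof -
  have "congruent2 (quandle_cong Q R) (quandle_cong Q R) (\<lambda>x y. quandle_cong Q R `` {x \<star> y})"
    by (rule congruent2I') (rule equiv_class_eq[OF equiv_quandle_cong quandle_cong.op])
  from UN_equiv_class2[OF equiv_quandle_cong equiv_quandle_cong this assms] show ?thesis
    by (simp add: quandle_quot_def)
qed

lemma (in quandle) right_cancel:
  "\<lbrakk>x \<star> y = x' \<star> y; x \<in> carrier Q; x' \<in> carrier Q; y \<in> carrier Q\<rbrakk> \<Longrightarrow> x = x'"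
  using right_div[of "x \<star> y" y] closed by metis

lemma quandle_cong_hom:
  assumes "quandle P" "f \<in> quandle_hom P Q"
    and "\<And>x y. \<lbrakk>(x, y) \<in> R; x \<in> carrier P; y \<in> carrier P\<rbrakk> \<Longrightarrow> (f x, f y) \<in> quandle_cong Q R'"
    and "(x, y) \<in> quandle_cong P R"
  shows "(f x, f y) \<in> quandle_cong Q R'"
  using assms(4)
proof (induction rule: quandle_cong.induct)
  case (op x x' y y')
  note c = op.hyps[THEN quandle.quandle_cong_closed[OF assms(1)]]
  show ?case
    using quandle_cong.op[OF op.IH] assms(2) c by (simp add: quandle_hom_def)
next
  case (cancel x y x' y')
  then have "(f x \<star>\<^bsub>Q\<^esub> f y, f x' \<star>\<^bsub>Q\<^esub> f y') \<in> quandle_cong Q R'"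
    using assms(2) quandle.quandle_cong_closed[OF assms(1) cancel.hyps(2)]
    by (auto simp: quandle_hom_def)
  then show ?case
    using cancel assms(2) by (auto simp: quandle_hom_def intro: quandle_cong.cancel)
qed (use assms(2,3) in \<open>auto simp: quandle_hom_def intro: quandle_cong.refl quandle_cong.sym
  quandle_cong.trans\<close>)

text \<open>
  The rule \<open>quandle_cong.cancel\<close> is respected by \<open>f\<close> because right division is unique in the
  target.
\<close>

lemma quandle_cong_kernel:
  assumes "quandle P" "quandle Q" "f \<in> quandle_hom P Q"
    and "\<And>x y. \<lbrakk>(x, y) \<in> R; x \<in> carrier P; y \<in> carrier P\<rbrakk> \<Longrightarrow> f x = f y"
    and "(x, y) \<in> quandle_cong P R"
  shows "f x = f y"
  using assms(5)
proof (induction rule: quandle_cong.induct)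
  case (op x x' y y')
  note c = op.hyps[THEN quandle.quandle_cong_closed[OF assms(1)]]
  show ?case
    using op.IH assms(3) c by (simp add: quandle_hom_def)
next
  case (cancel x y x' y')
  then have y: "y \<in> carrier P" "y' \<in> carrier P" and e: "f y = f y'"
    using quandle.quandle_cong_closed[OF assms(1)] by auto
  have "f x \<star>\<^bsub>Q\<^esub> f y = f x' \<star>\<^bsub>Q\<^esub> f y'"
    using cancel y assms(3) by (auto simp: quandle_hom_def)
  then show ?case
    using quandle.right_cancel[OF assms(2), of "f x" "f y" "f x'"] e cancel y assms(3)
    by (auto simp: quandle_hom_def)
qed (use assms(4) in auto)

lemma quandle_transport:
  assumes "quandle Q" "f \<in> quandle_hom P Q" "bij_betw f (carrier P) (carrier Q)"
    and P: "\<And>x y. \<lbrakk>x \<in> carrier P; y \<in> carrier P\<rbrakk> \<Longrightarrow> x \<star>\<^bsub>P\<^esub> y \<in> carrier P"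
  shows "quandle P"
proof -
  interpret Q: quandle Q by fact
  have f: "f x \<in> carrier Q" if "x \<in> carrier P" for x
    using that assms(2) by (auto simp: quandle_hom_def)
  have hom: "f (x \<star>\<^bsub>P\<^esub> y) = f x \<star>\<^bsub>Q\<^esub> f y" if "x \<in> carrier P" "y \<in> carrier P" for x y
    using that assms(2) by (auto simp: quandle_hom_def)
  have inj: "x = y" if "f x = f y" "x \<in> carrier P" "y \<in> carrier P" for x y
    using that assms(3) by (auto simp: bij_betw_def inj_on_def)
  show ?thesis
  proof
    show "carrier P \<noteq> {}"
      using assms(3) Q.nonempty by (auto simp: bij_betw_def)
    fix x y assume x: "x \<in> carrier P"
    show "x \<star>\<^bsub>P\<^esub> x = x"
      by (rule inj) (simp_all add: x P hom f Q.idem)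
    assume y: "y \<in> carrier P"
    show "\<exists>!z. z \<in> carrier P \<and> x = z \<star>\<^bsub>P\<^esub> y"
    proof (rule ex_ex1I)
      obtain z where "z \<in> carrier Q" "f x = z \<star>\<^bsub>Q\<^esub> f y"
        using Q.right_div[OF f[OF x] f[OF y]] by blast
      moreover then obtain z' where "z' \<in> carrier P" "z = f z'"
        using assms(3) by (auto simp: bij_betw_def)
      ultimately show "\<exists>z. z \<in> carrier P \<and> x = z \<star>\<^bsub>P\<^esub> y"
        using x y by (intro exI[of _ z']) (auto intro!: inj simp: P hom)
    next
      fix z z' assume "z \<in> carrier P \<and> x = z \<star>\<^bsub>P\<^esub> y" "z' \<in> carrier P \<and> x = z' \<star>\<^bsub>P\<^esub> y"
      then show "z = z'"
        by (metis Q.right_cancel f hom inj y)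
    qed
    fix z assume z: "z \<in> carrier P"
    show "x \<star>\<^bsub>P\<^esub> y \<star>\<^bsub>P\<^esub> z = (x \<star>\<^bsub>P\<^esub> z) \<star>\<^bsub>P\<^esub> (y \<star>\<^bsub>P\<^esub> z)"
      by (rule inj) (simp_all add: x y z P hom f Q.distrib)
  qed (fact P)
qed

text \<open>
  The first isomorphism theorem. That the quotient is itself a quandle is not proved from the
  congruence: the axioms are pulled back along the bijection onto \<open>Q\<close>.
\<close>

lemma quandle_quot_isomorphic:
  assumes "quandle P" "quandle Q" "f \<in> quandle_hom P Q" "f ` carrier P = carrier Q"
    and ker: "\<And>x y. \<lbrakk>x \<in> carrier P; y \<in> carrier P\<rbrakk> \<Longrightarrow> f x = f y \<longleftrightarrow> (x, y) \<in> quandle_cong P R"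
  shows "quandle_isomorphic (quandle_quot P R) Q"
proof -
  interpret P: quandle P by fact
  define F where "F X = the_elem (f ` X)" for X
  have F: "F (quandle_cong P R `` {x}) = f x" if "x \<in> carrier P" for x
    unfolding F_def
  proof (rule the_elem_image_unique)
    show "quandle_cong P R `` {x} \<noteq> {}"
      using quandle_cong.refl[OF that] by blast
    show "f y = f x" if "y \<in> quandle_cong P R `` {x}" for y
      using that ker P.quandle_cong_closed by (metis Image_singleton_iff)
  qed
  have carr: "\<exists>x\<in>carrier P. X = quandle_cong P R `` {x}" if "X \<in> carrier (quandle_quot P R)" for X
    using that by (auto simp: quandle_quot_def elim!: quotientE)
  have carr': "quandle_cong P R `` {x} \<in> carrier (quandle_quot P R)" if "x \<in> carrier P" for x
    using that by (auto simp: quandle_quot_def intro: quotientI)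
  have hom: "F \<in> quandle_hom (quandle_quot P R) Q"
    using assms(3) by (auto simp: quandle_hom_def dest!: carr simp: P.quandle_quot_op F P.closed)
  have inj: "inj_on F (carrier (quandle_quot P R))"
  proof (rule inj_onI)
    fix X Y assume XY: "X \<in> carrier (quandle_quot P R)" "Y \<in> carrier (quandle_quot P R)"
      and "F X = F Y"
    then obtain x y where "x \<in> carrier P" "y \<in> carrier P" "f x = f y"
      "X = quandle_cong P R `` {x}" "Y = quandle_cong P R `` {y}"
      using carr F by metis
    then show "X = Y"
      using ker equiv_class_eq[OF P.equiv_quandle_cong] by simp
  qed
  have surj: "F ` carrier (quandle_quot P R) = carrier Q"
  proof
    show "F ` carrier (quandle_quot P R) \<subseteq> carrier Q"
      using hom by (auto simp: quandle_hom_def)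
    show "carrier Q \<subseteq> F ` carrier (quandle_quot P R)"
      using F carr' assms(4) by (metis (no_types, lifting) image_iff subsetI)
  qed
  have "quandle (quandle_quot P R)"
    using assms(2) hom
    by (rule quandle_transport)
      (use inj surj in \<open>auto simp: bij_betw_def dest!: carr simp: P.quandle_quot_op P.closed carr'\<close>)
  then show ?thesis
    using assms(2) hom inj surj by (auto simp: quandle_isomorphic_def quandle_iso_def bij_betw_def)
qed

section \<open>Dehn quandles\<close>

lemma dehn_quandle_op [simp]:
  "x \<star>\<^bsub>dehn_quandle G A\<^esub> y = y \<otimes>\<^bsub>G\<^esub> x \<otimes>\<^bsub>G\<^esub> inv\<^bsub>G\<^esub> y"
  by (simp add: dehn_quandle_def)

lemma (in group) conj_conj:
  assumes "g \<in> carrier G" "h \<in> carrier G" "x \<in> carrier G"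
  shows "g \<otimes> (h \<otimes> x \<otimes> inv h) \<otimes> inv g = (g \<otimes> h) \<otimes> x \<otimes> inv (g \<otimes> h)"
  using assms by (simp add: m_assoc inv_mult_group)

lemma (in group) conj_mult:
  assumes "g \<in> carrier G" "x \<in> carrier G" "y \<in> carrier G"
  shows "g \<otimes> (x \<otimes> y) \<otimes> inv g = (g \<otimes> x \<otimes> inv g) \<otimes> (g \<otimes> y \<otimes> inv g)"
  using assms by (simp add: m_assoc inv_solve_left)

lemma (in group) conj_conj_distrib:
  assumes "g \<in> carrier G" "y \<in> carrier G" "x \<in> carrier G"
  shows "g \<otimes> (y \<otimes> x \<otimes> inv y) \<otimes> inv g
    = (g \<otimes> y \<otimes> inv g) \<otimes> (g \<otimes> x \<otimes> inv g) \<otimes> inv (g \<otimes> y \<otimes> inv g)"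
proof -
  have "(g \<otimes> y \<otimes> inv g) \<otimes> g = g \<otimes> y"
    using assms by (simp add: m_assoc)
  then show ?thesis
    using assms by (simp add: conj_conj)
qed

lemma dehn_quandleE:
  assumes "x \<in> carrier (dehn_quandle G A)"
  obtains g a where "g \<in> carrier G" "a \<in> A" "x = g \<otimes>\<^bsub>G\<^esub> a \<otimes>\<^bsub>G\<^esub> inv\<^bsub>G\<^esub> g"
  using assms by (auto simp: dehn_quandle_def)

lemma (in group) dehn_quandle_closed:
  "A \<subseteq> carrier G \<Longrightarrow> x \<in> carrier (dehn_quandle G A) \<Longrightarrow> x \<in> carrier G"
  by (auto simp: dehn_quandle_def)

lemma (in group) dehn_quandle_conj:
  assumes "A \<subseteq> carrier G" "g \<in> carrier G" "x \<in> carrier (dehn_quandle G A)"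
  shows "g \<otimes> x \<otimes> inv g \<in> carrier (dehn_quandle G A)"
proof -
  obtain h a where "h \<in> carrier G" "a \<in> A" "x = h \<otimes> a \<otimes> inv h"
    using assms(3) by (auto simp: dehn_quandle_def)
  moreover then have "g \<otimes> x \<otimes> inv g = (g \<otimes> h) \<otimes> a \<otimes> inv (g \<otimes> h)"
    using assms by (auto intro: conj_conj)
  ultimately show ?thesis
    using assms(2) by (auto simp: dehn_quandle_def)
qed

lemma (in group) dehn_quandle_base:
  assumes "A \<subseteq> carrier G" "a \<in> A"
  shows "a \<in> carrier (dehn_quandle G A)"
proof -
  have "a = \<one> \<otimes> a \<otimes> inv \<one>" using assms by auto
  then have "a \<in> {g \<otimes> a \<otimes> inv g | g a. g \<in> carrier G \<and> a \<in> A}"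
    using assms(2) one_closed by blast
  then show ?thesis by (simp add: dehn_quandle_def)
qed

lemma (in group) conj_inverse_cancel:
  assumes "g \<in> carrier G" "x \<in> carrier G"
  shows "g \<otimes> (inv g \<otimes> x \<otimes> g) \<otimes> inv g = x" "inv g \<otimes> (g \<otimes> x \<otimes> inv g) \<otimes> g = x"
  using conj_conj[of g "inv g" x] conj_conj[of "inv g" g x] assms by simp_all

lemma (in group) quandle_dehn_quandle:
  assumes "A \<subseteq> carrier G" "A \<noteq> {}"
  shows "quandle (dehn_quandle G A)"
proof
  note [simp] = dehn_quandle_closed[OF assms(1)]
  show "carrier (dehn_quandle G A) \<noteq> {}"
    using assms dehn_quandle_base by blast
  fix x y assume x: "x \<in> carrier (dehn_quandle G A)"
  show "x \<star>\<^bsub>dehn_quandle G A\<^esub> x = x"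
    using x by (simp add: m_assoc)
  assume y: "y \<in> carrier (dehn_quandle G A)"
  show "x \<star>\<^bsub>dehn_quandle G A\<^esub> y \<in> carrier (dehn_quandle G A)"
    using x y dehn_quandle_conj[OF assms(1), of y x] by simp
  show "\<exists>!z. z \<in> carrier (dehn_quandle G A) \<and> x = z \<star>\<^bsub>dehn_quandle G A\<^esub> y"
  proof (rule ex1I[of _ "inv y \<otimes> x \<otimes> y"])
    show "inv y \<otimes> x \<otimes> y \<in> carrier (dehn_quandle G A) \<and>
      x = inv y \<otimes> x \<otimes> y \<star>\<^bsub>dehn_quandle G A\<^esub> y"
      using dehn_quandle_conj[OF assms(1), of "inv y" x] x y by (simp add: conj_inverse_cancel)
  qed (use x y in \<open>auto simp: conj_inverse_cancel\<close>)
  fix z assume z: "z \<in> carrier (dehn_quandle G A)"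
  show "x \<star>\<^bsub>dehn_quandle G A\<^esub> y \<star>\<^bsub>dehn_quandle G A\<^esub> z =
    (x \<star>\<^bsub>dehn_quandle G A\<^esub> z) \<star>\<^bsub>dehn_quandle G A\<^esub> (y \<star>\<^bsub>dehn_quandle G A\<^esub> z)"
    using x y z conj_conj_distrib[of z y x] by simp
qed

section \<open>The involutory quotient of a Dehn quandle\<close>

locale dehn_group = group +
  fixes S :: "'a set"
  assumes S_closed: "S \<subseteq> carrier G" and S_nonempty: "S \<noteq> {}"
begin

abbreviation X :: "'a set" where
  "X \<equiv> carrier (dehn_quandle G S)"

definition invol_cong :: "'a \<Rightarrow> 'a \<Rightarrow> bool" (infix \<open>\<approx>\<close> 50) where
  "x \<approx> y \<longleftrightarrow> (x, y) \<in> quandle_cong (dehn_quandle G S)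
     {((x \<star>\<^bsub>dehn_quandle G S\<^esub> y) \<star>\<^bsub>dehn_quandle G S\<^esub> y, x) | x y. x \<in> X \<and> y \<in> X}"

definition square_closure :: "'a set" where
  "square_closure = normal_closure G {s \<otimes> s | s. s \<in> S}"

sublocale D: quandle "dehn_quandle G S"
  using quandle_dehn_quandle[OF S_closed S_nonempty] .

lemmas X_closed [simp] = dehn_quandle_closed[OF S_closed]
lemmas X_conj = dehn_quandle_conj[OF S_closed]
lemmas S_in_X = dehn_quandle_base[OF S_closed]

lemma invol_cong_X: "x \<approx> y \<Longrightarrow> x \<in> X" "x \<approx> y \<Longrightarrow> y \<in> X"
  using D.quandle_cong_closed by (auto simp: invol_cong_def)

lemma invol_refl: "x \<in> X \<Longrightarrow> x \<approx> x"
  by (auto simp: invol_cong_def intro: quandle_cong.refl)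

lemma invol_sym: "x \<approx> y \<Longrightarrow> y \<approx> x"
  by (auto simp: invol_cong_def intro: quandle_cong.sym)

lemma invol_trans [trans]: "x \<approx> y \<Longrightarrow> y \<approx> z \<Longrightarrow> x \<approx> z"
  by (auto simp: invol_cong_def intro: quandle_cong.trans)

lemma invol_square:
  assumes "x \<in> X" "y \<in> X"
  shows "(y \<otimes> y) \<otimes> x \<otimes> inv (y \<otimes> y) \<approx> x"
proof -
  have "y \<otimes> (y \<otimes> x \<otimes> inv y) \<otimes> inv y \<approx> x"
    unfolding invol_cong_def
    using assms X_conj[of y x] X_conj[of y "y \<otimes> x \<otimes> inv y"] by (intro quandle_cong.base) auto
  then show ?thesis
    using assms conj_conj by simp
qed

text \<open>
  Conjugation by \<open>g\<close> is an automorphism of the Dehn quandle that permutes the defining relations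
  of the involutory quotient.
\<close>

lemma invol_conj:
  assumes "g \<in> carrier G" "x \<approx> y"
  shows "g \<otimes> x \<otimes> inv g \<approx> g \<otimes> y \<otimes> inv g"
proof -
  have hom: "(\<lambda>x. g \<otimes> x \<otimes> inv g) \<in> quandle_hom (dehn_quandle G S) (dehn_quandle G S)"
    using assms(1) X_conj[OF assms(1)] conj_conj_distrib[OF assms(1)]
    by (simp add: quandle_hom_def Pi_iff)
  show ?thesis
    using assms(2) unfolding invol_cong_def
  proof (rule quandle_cong_hom[OF D.quandle_axioms hom, rotated])
    let ?R = "{((x \<star>\<^bsub>dehn_quandle G S\<^esub> y) \<star>\<^bsub>dehn_quandle G S\<^esub> y, x) | x y. x \<in> X \<and> y \<in> X}"
    fix x y assume "(x, y) \<in> ?R"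
    then obtain z where z: "z \<in> X" "y \<in> X" "x = (z \<otimes> z) \<otimes> y \<otimes> inv (z \<otimes> z)"
      by (auto simp: conj_conj)
    let ?z = "g \<otimes> z \<otimes> inv g" and ?y = "g \<otimes> y \<otimes> inv g"
    have "g \<otimes> x \<otimes> inv g = (?z \<otimes> ?z) \<otimes> ?y \<otimes> inv (?z \<otimes> ?z)"
      using z assms(1) conj_conj_distrib[of g "z \<otimes> z" y] conj_mult[of g z z] by simp
    then show "(g \<otimes> x \<otimes> inv g, ?y) \<in> quandle_cong (dehn_quandle G S) ?R"
      using invol_square[OF X_conj[OF assms(1) z(2)] X_conj[OF assms(1) z(1)]]
      unfolding invol_cong_def by simp
  qed
qed

lemma invol_conj_iff:
  assumes "g \<in> carrier G" "x \<in> X" "y \<in> X"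
  shows "inv g \<otimes> x \<otimes> g \<approx> y \<longleftrightarrow> x \<approx> g \<otimes> y \<otimes> inv g"
proof
  assume "inv g \<otimes> x \<otimes> g \<approx> y"
  from invol_conj[OF assms(1) this] show "x \<approx> g \<otimes> y \<otimes> inv g"
    using assms by (simp add: conj_inverse_cancel)
next
  assume "x \<approx> g \<otimes> y \<otimes> inv g"
  from invol_conj[OF inv_closed[OF assms(1)] this] show "inv g \<otimes> x \<otimes> g \<approx> y"
    using assms by (simp add: conj_inverse_cancel)
qed

lemma squares_closed: "{s \<otimes> s | s. s \<in> S} \<subseteq> carrier G"
  using S_closed by auto

lemma normal_square_closure: "square_closure \<lhd> G"
  unfolding square_closure_def by (rule normal_normal_closure[OF squares_closed])

lemma square_closure_closed: "h \<in> square_closure \<Longrightarrow> h \<in> carrier G"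
  using subgroup.mem_carrier[OF normal_imp_subgroup[OF normal_square_closure]] .

text \<open>
  A conjugate of the square of a generator is the square of an element of the Dehn quandle, so
  those squares generate the normal closure as a group.
\<close>

lemma square_closure_induct [consumes 1, case_names one square inv mult]:
  assumes "h \<in> square_closure"
    and "P \<one>"
    and "\<And>y. y \<in> X \<Longrightarrow> P (y \<otimes> y)"
    and "\<And>y. y \<in> X \<Longrightarrow> P (inv (y \<otimes> y))"
    and "\<And>h k. \<lbrakk>h \<in> square_closure; k \<in> square_closure; P h; P k\<rbrakk> \<Longrightarrow> P (h \<otimes> k)"
  shows "P h"
proof -
  have sq: "\<exists>y\<in>X. h = y \<otimes> y"
    if "h \<in> {g \<otimes> x \<otimes> inv g | g x. g \<in> carrier G \<and> x \<in> {s \<otimes> s | s. s \<in> S}}" for h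
  proof -
    obtain g s where gs: "g \<in> carrier G" "s \<in> S" "h = g \<otimes> (s \<otimes> s) \<otimes> inv g"
      using \<open>h \<in> _\<close> by auto
    then have "h = (g \<otimes> s \<otimes> inv g) \<otimes> (g \<otimes> s \<otimes> inv g)"
      using S_closed conj_mult by auto
    then show ?thesis
      using X_conj[OF gs(1) S_in_X[OF gs(2)]] by blast
  qed
  show ?thesis
    using assms(1) unfolding square_closure_def normal_closure_def
  proof (induction rule: generate.induct)
    case (eng h1 h2)
    then show ?case
      using assms(5) by (simp add: square_closure_def normal_closure_def)
  next
    case (incl h)
    from sq[OF this] show ?case using assms(3) by blast
  next
    case (inv h)
    from sq[OF this] show ?case using assms(4) by blast
  qed (rule assms(2))
qed

text \<open>
  Conjugation by \<open>y \<otimes> y\<close> is the operation \<open>x \<mapsto> (x \<star> y) \<star> y\<close>. Hence the group modulo the squares,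
  the Coxeter group in the application, acts on the involutory quotient.
\<close>

lemma square_closure_acts_trivially:
  assumes "h \<in> square_closure" "x \<in> X"
  shows "h \<otimes> x \<otimes> inv h \<approx> x"
  using assms
proof (induction arbitrary: x rule: square_closure_induct)
  case one
  then show ?case by (simp add: invol_refl)
next
  case (square y)
  then show ?case by (intro invol_square)
next
  case (inv y)
  have "(y \<otimes> y) \<otimes> x \<otimes> inv (y \<otimes> y) \<approx> x"
    using inv by (intro invol_square)
  then have "inv (y \<otimes> y) \<otimes> x \<otimes> inv (inv (y \<otimes> y)) \<approx>
      inv (y \<otimes> y) \<otimes> ((y \<otimes> y) \<otimes> x \<otimes> inv (y \<otimes> y)) \<otimes> inv (inv (y \<otimes> y))"
    using inv by (intro invol_conj[OF _ invol_sym]) auto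
  also have "\<dots> = x"
    using inv conj_inverse_cancel(2)[of "y \<otimes> y" x] by simp
  finally show ?case .
next
  case (mult h k)
  have "h \<otimes> (k \<otimes> x \<otimes> inv k) \<otimes> inv h \<approx> h \<otimes> x \<otimes> inv h"
    using mult by (intro invol_conj square_closure_closed)
  also have "h \<otimes> x \<otimes> inv h \<approx> x"
    using mult by simp
  finally show ?case
    using mult by (simp add: conj_conj square_closure_closed)
qed

end

section \<open>The reflection cocycle\<close>

text \<open>
  A crossed homomorphism \<open>c\<close> from \<open>G\<close> to the functions on the Dehn quandle with values modulo 2,
  on which \<open>G\<close> acts by conjugation of the argument. For a Coxeter group the classical model is
  \<open>c g x = 1\<close> if and only if the reflection \<open>x\<close> occurs an odd number of times among the
  reflections belonging to the letters of a word for \<open>g\<close>. Here those reflections are counted in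
  the involutory quotient, which could a priori be larger than the set of reflections.
\<close>

locale reflection_cocycle = dehn_group +
  fixes c :: "'a \<Rightarrow> 'a \<Rightarrow> bit"
  assumes generated: "carrier G = generate G S"
    and c_mult: "\<lbrakk>g \<in> carrier G; h \<in> carrier G; x \<in> carrier G\<rbrakk>
      \<Longrightarrow> c (g \<otimes> h) x = c g x + c h (inv g \<otimes> x \<otimes> g)"
    and c_gen: "\<lbrakk>s \<in> S; x \<in> X\<rbrakk> \<Longrightarrow> c s x = of_bool (x \<approx> s)"
begin

lemma c_one: "x \<in> carrier G \<Longrightarrow> c \<one> x = 0"
  using c_mult[of \<one> \<one> x] by simp

lemma c_inv:
  assumes "g \<in> carrier G" "x \<in> carrier G"
  shows "c (inv g) x = c g (g \<otimes> x \<otimes> inv g)"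
proof -
  have "c (inv g) x + c g (g \<otimes> x \<otimes> inv g) = 0"
    using c_mult[of "inv g" g x] c_one[OF assms(2)] assms by simp
  then show ?thesis
    by (cases "c (inv g) x"; cases "c g (g \<otimes> x \<otimes> inv g)") simp_all
qed

lemma c_cong:
  assumes "g \<in> carrier G" "x \<approx> y"
  shows "c g x = c g y"
proof -
  have gen: "c s x = c s y" if "s \<in> S" "x \<approx> y" for s x y
  proof -
    have "x \<approx> s \<longleftrightarrow> y \<approx> s" using that(2) invol_sym invol_trans by blast
    then show ?thesis using that(1) invol_cong_X[OF that(2)] by (simp add: c_gen)
  qed
  have "g \<in> generate G S"
    using assms(1) generated by simp
  then have "g \<in> carrier G \<and> (\<forall>x y. x \<approx> y \<longrightarrow> c g x = c g y)"
  proof (induction rule: generate.induct)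
    case one
    then show ?case using c_one X_closed invol_cong_X by simp
  next
    case (incl s)
    then show ?case using gen S_closed by blast
  next
    case (inv s)
    then have "s \<in> carrier G" using S_closed by blast
    moreover have "c (inv s) x = c (inv s) y" if "x \<approx> y" for x y
      using gen[OF inv invol_conj[OF \<open>s \<in> carrier G\<close> that]] invol_cong_X[OF that] \<open>s \<in> carrier G\<close>
      by (simp add: c_inv)
    ultimately show ?case by blast
  next
    case (eng g h)
    have "c (g \<otimes> h) x = c (g \<otimes> h) y" if "x \<approx> y" for x y
    proof -
      have "inv g \<otimes> x \<otimes> g \<approx> inv g \<otimes> y \<otimes> g"
        using invol_conj[OF inv_closed that] eng by simp
      then show ?thesis
        using eng that invol_cong_X[OF that] by (simp add: c_mult)
    qed
    then show ?case using eng by simp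
  qed
  then show ?thesis using assms(2) by blast
qed

text \<open>
  With \<open>x = w s w\<inverse>\<close> the rule for a product gives three terms. The middle one, from \<open>s\<close>, is the
  claimed value. The outer ones are \<open>c w\<close> at \<open>y\<close> and at \<open>x\<inverse> y x\<close>, and these cancel modulo 2
  since \<open>x\<close> fixes the class of \<open>y\<close>.
\<close>

lemma c_reflection:
  assumes "x \<in> X" "y \<in> X" "inv x \<otimes> y \<otimes> x \<approx> y"
  shows "c x y = of_bool (y \<approx> x)"
proof -
  obtain w s where ws: "w \<in> carrier G" "s \<in> S" and x: "x = w \<otimes> s \<otimes> inv w"
    using assms(1) by (rule dehn_quandleE)
  have s: "s \<in> carrier G" "s \<in> X" using ws S_closed S_in_X by auto
  have y: "y \<in> carrier G" "inv w \<otimes> y \<otimes> w \<in> X"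
    using assms X_conj[OF inv_closed[OF ws(1)] assms(2)] ws by simp_all
  have e: "w \<otimes> (inv s \<otimes> (inv w \<otimes> y \<otimes> w) \<otimes> s) \<otimes> inv w = inv x \<otimes> y \<otimes> x"
    using ws s y by (simp add: x m_assoc inv_mult_group)
  have "c x y = c w y + (c s (inv w \<otimes> y \<otimes> w)
      + c (inv w) (inv s \<otimes> (inv w \<otimes> y \<otimes> w) \<otimes> s))"
    using ws s y by (simp add: x m_assoc c_mult)
  also have "c (inv w) (inv s \<otimes> (inv w \<otimes> y \<otimes> w) \<otimes> s) = c w (inv x \<otimes> y \<otimes> x)"
    using ws s y e by (simp add: c_inv)
  also have "\<dots> = c w y"
    using c_cong[OF ws(1) assms(3)] .
  also have "c s (inv w \<otimes> y \<otimes> w) = of_bool (y \<approx> x)"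
    using c_gen[OF ws(2) y(2)] invol_conj_iff[OF ws(1) assms(2) s(2)] x by simp
  finally show ?thesis
    by (cases "c w y") auto
qed

text \<open>
  Write \<open>y = w s w\<inverse>\<close>, so that \<open>y y = w s s w\<inverse>\<close>. The square of the generator \<open>s\<close> contributes the
  class of \<open>s\<close> twice, hence nothing, and it acts trivially on classes, so that the contributions
  of \<open>w\<close> and \<open>w\<inverse>\<close> cancel.
\<close>

lemma c_square:
  assumes "y \<in> X" "x \<in> X"
  shows "c (y \<otimes> y) x = 0"
proof -
  obtain w s where ws: "w \<in> carrier G" "s \<in> S" and y: "y = w \<otimes> s \<otimes> inv w"
    using assms(1) by (rule dehn_quandleE)
  let ?z = "inv w \<otimes> x \<otimes> w"
  have s: "s \<in> carrier G" "s \<in> X" using ws S_closed S_in_X by auto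
  have z: "?z \<in> X" "inv s \<otimes> ?z \<otimes> s \<in> X"
    using X_conj[OF inv_closed[OF ws(1)] assms(2)] X_conj[OF inv_closed[OF s(1)]] ws s by simp_all
  have ss: "c (s \<otimes> s) ?z = 0"
    using ws s z invol_conj_iff[OF s(1) z(1) s(2)] by (simp add: c_mult c_gen m_assoc)
  have "inv (s \<otimes> s) \<otimes> ?z \<otimes> (s \<otimes> s) \<approx> ?z"
    using invol_conj[OF inv_closed invol_square[OF z(1) s(2)], of "s \<otimes> s"] s z
    by (auto simp: conj_inverse_cancel dest: invol_sym)
  then have "c (inv w) (inv (s \<otimes> s) \<otimes> ?z \<otimes> (s \<otimes> s)) = c (inv w) ?z"
    using ws by (intro c_cong) auto
  also have "\<dots> = c w x"
    using ws assms by (simp add: c_inv conj_inverse_cancel)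
  finally have "c ((s \<otimes> s) \<otimes> inv w) ?z = c w x"
    using c_mult[of "s \<otimes> s" "inv w" ?z] ws s z ss by simp
  moreover have "y \<otimes> y = w \<otimes> ((s \<otimes> s) \<otimes> inv w)"
    using ws s conj_mult[of w s s] by (simp add: y flip: m_assoc)
  ultimately show ?thesis
    using c_mult[of w "(s \<otimes> s) \<otimes> inv w" x] ws s assms by simp
qed

lemma c_square_closure:
  assumes "h \<in> square_closure" "x \<in> X"
  shows "c h x = 0"
  using assms
proof (induction arbitrary: x rule: square_closure_induct)
  case one
  then show ?case by (simp add: c_one)
next
  case (square y)
  then show ?case by (rule c_square)
next
  case (inv y)
  then show ?case
    using c_square[OF inv(1) X_conj[of "y \<otimes> y" x]] by (simp add: c_inv del: inv_mult_group)
next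
  case (mult h k)
  have "inv h \<otimes> x \<otimes> h \<in> X"
    using X_conj[OF inv_closed, of h x] mult square_closure_closed by simp
  then show ?case using mult by (simp add: c_mult square_closure_closed)
qed

text \<open>
  Put \<open>x = h y\<close>. Since \<open>c h\<close> vanishes and \<open>h\<close> acts trivially on classes, \<open>c x y = c y y\<close>. Moreover
  \<open>x\<close> acts on classes as \<open>y\<close> does and so fixes the class of \<open>y\<close>; thus \<open>c_reflection\<close> evaluates both
  sides, the right one to 1 and the left one to 1 only if \<open>y \<approx> x\<close>.
\<close>

theorem invol_cong_if_coset_eq:
  assumes "x \<in> X" "y \<in> X" "x \<otimes> inv y \<in> square_closure"
  shows "x \<approx> y"
proof -
  let ?h = "x \<otimes> inv y"
  have conj: "inv ?h \<otimes> y \<otimes> ?h \<approx> y"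
  proof -
    have "inv ?h \<in> square_closure"
      using subgroup.m_inv_closed[OF normal_imp_subgroup[OF normal_square_closure] assms(3)] .
    from square_closure_acts_trivially[OF this assms(2)] show ?thesis
      using assms by simp
  qed
  have "c x y = c ?h y + c y (inv ?h \<otimes> y \<otimes> ?h)"
    using c_mult[of ?h y y] assms by (simp add: m_assoc)
  also have "\<dots> = c y y"
    using c_square_closure[OF assms(3,2)] c_cong[OF _ conj] assms by simp
  also have "\<dots> = 1"
    using c_reflection[OF assms(2,2)] invol_refl assms(2) by (simp add: m_assoc)
  finally have "c x y = 1" .
  moreover have "inv x \<otimes> y \<otimes> x \<approx> y"
  proof -
    have cancel: "inv y \<otimes> (y \<otimes> z) = z" if "z \<in> carrier G" for z
      using that assms by (simp flip: m_assoc)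
    have "inv x \<otimes> y \<otimes> x = inv y \<otimes> (inv ?h \<otimes> y \<otimes> ?h) \<otimes> inv (inv y)"
      using assms cancel by (simp add: m_assoc inv_mult_group)
    also have "\<dots> \<approx> inv y \<otimes> y \<otimes> inv (inv y)"
      using assms(2) by (intro invol_conj conj) simp
    finally show ?thesis
      using assms by simp
  qed
  ultimately have "y \<approx> x"
    using c_reflection[OF assms(1,2)] by (auto split: if_splits)
  then show ?thesis by (rule invol_sym)
qed

end

section \<open>Existence of the cocycle\<close>

definition conj_translate ::
  "('a, 'm) monoid_scheme \<Rightarrow> 'a \<Rightarrow> ('a \<Rightarrow> bit) \<Rightarrow> 'a \<Rightarrow> bit" where
  "conj_translate G g f = (\<lambda>x. if x \<in> carrier G then f (inv\<^bsub>G\<^esub> g \<otimes>\<^bsub>G\<^esub> x \<otimes>\<^bsub>G\<^esub> g) else 0)"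

text \<open>
  The semidirect product of \<open>G\<close> with the group of functions \<open>carrier G \<rightarrow> \<int>/2\<close>. A crossed
  homomorphism from \<open>G\<close> to these functions is the same as a homomorphic section of the projection
  onto \<open>G\<close>, which makes von Dyck's theorem applicable. Functions are normalised to 0 outside
  \<open>carrier G\<close> so that equality of elements is equality of pairs.
\<close>

definition bit_semidirect :: "('a, 'm) monoid_scheme \<Rightarrow> ('a \<times> ('a \<Rightarrow> bit)) monoid" where
  "bit_semidirect G =
     \<lparr>carrier = carrier G \<times> {f. \<forall>x. x \<notin> carrier G \<longrightarrow> f x = 0},
      mult = (\<lambda>p q. (fst p \<otimes>\<^bsub>G\<^esub> fst q, \<lambda>x. snd p x + conj_translate G (fst p) (snd q) x)),
      one = (\<one>\<^bsub>G\<^esub>, \<lambda>_. 0)\<rparr>"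

lemma (in group) group_bit_semidirect: "group (bit_semidirect G)"
proof (rule groupI)
  fix p q r
  assume p: "p \<in> carrier (bit_semidirect G)"
  have "(inv (fst p), conj_translate G (inv (fst p)) (snd p)) \<otimes>\<^bsub>bit_semidirect G\<^esub> p
      = \<one>\<^bsub>bit_semidirect G\<^esub>"
    "(inv (fst p), conj_translate G (inv (fst p)) (snd p)) \<in> carrier (bit_semidirect G)"
    using p by (auto simp: bit_semidirect_def conj_translate_def)
  then show "\<exists>q\<in>carrier (bit_semidirect G). q \<otimes>\<^bsub>bit_semidirect G\<^esub> p = \<one>\<^bsub>bit_semidirect G\<^esub>"
    by blast
  show "\<one>\<^bsub>bit_semidirect G\<^esub> \<otimes>\<^bsub>bit_semidirect G\<^esub> p = p"
    using p by (auto simp: bit_semidirect_def conj_translate_def fun_eq_iff prod_eq_iff)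
  assume q: "q \<in> carrier (bit_semidirect G)"
  show "p \<otimes>\<^bsub>bit_semidirect G\<^esub> q \<in> carrier (bit_semidirect G)"
    using p q by (auto simp: bit_semidirect_def conj_translate_def)
  assume r: "r \<in> carrier (bit_semidirect G)"
  show "p \<otimes>\<^bsub>bit_semidirect G\<^esub> q \<otimes>\<^bsub>bit_semidirect G\<^esub> r =
    p \<otimes>\<^bsub>bit_semidirect G\<^esub> (q \<otimes>\<^bsub>bit_semidirect G\<^esub> r)"
    using p q r
    by (auto simp: bit_semidirect_def conj_translate_def fun_eq_iff m_assoc inv_mult_group add.assoc)
qed (simp add: bit_semidirect_def)

lemma (in group) alternating_closed:
  "\<lbrakk>x \<in> carrier G; y \<in> carrier G\<rbrakk> \<Longrightarrow> alternating G x y k \<in> carrier G"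
  by (induction k arbitrary: x y) auto

lemma alternating_hom:
  assumes "group G" "group H" "f \<in> hom G H" "x \<in> carrier G" "y \<in> carrier G"
  shows "f (alternating G x y k) = alternating H (f x) (f y) k"
proof -
  interpret group_hom G H f
    using assms by (simp add: group_hom_def group_hom_axioms_def)
  show ?thesis
    using assms(4,5) by (induction k arbitrary: x y) (auto simp: G.alternating_closed)
qed

text \<open>
  The element \<open>p z p\<inverse>\<close>, where \<open>p\<close> is the alternating product of the first \<open>l\<close> factors of
  \<open>x y x \<dots>\<close> and \<open>z\<close> is the next factor.
\<close>

primrec dihedral_reflection :: "('a, 'm) monoid_scheme \<Rightarrow> 'a \<Rightarrow> 'a \<Rightarrow> nat \<Rightarrow> 'a" where
  "dihedral_reflection G x y 0 = x"
| "dihedral_reflection G x y (Suc l) =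
     x \<otimes>\<^bsub>G\<^esub> dihedral_reflection G y x l \<otimes>\<^bsub>G\<^esub> inv\<^bsub>G\<^esub> x"

lemma (in group) dihedral_reflection_closed:
  "\<lbrakk>x \<in> carrier G; y \<in> carrier G\<rbrakk> \<Longrightarrow> dihedral_reflection G x y l \<in> carrier G"
  by (induction l arbitrary: x y) auto

lemma (in group) dihedral_reflection_alternating:
  assumes "x \<in> carrier G" "y \<in> carrier G"
  shows "dihedral_reflection G x y l \<otimes> alternating G x y l = alternating G x y (Suc l)"
  using assms
proof (induction l arbitrary: x y)
  case (Suc l)
  have "inv x \<otimes> (x \<otimes> alternating G y x l) = alternating G y x l"
    using Suc.prems alternating_closed by (simp flip: m_assoc)
  then have "dihedral_reflection G x y (Suc l) \<otimes> alternating G x y (Suc l)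
      = x \<otimes> (dihedral_reflection G y x l \<otimes> alternating G y x l)"
    using Suc.prems dihedral_reflection_closed alternating_closed by (simp add: m_assoc)
  also have "\<dots> = x \<otimes> alternating G y x (Suc l)"
    using Suc.IH[of y x] Suc.prems dihedral_reflection_closed by simp
  finally show ?case by simp
qed simp

context dehn_group
begin

lemma dihedral_reflection_X:
  assumes "x \<in> S" "y \<in> S"
  shows "dihedral_reflection G x y l \<in> X"
  using assms
proof (induction l arbitrary: x y)
  case (Suc l)
  then show ?case using X_conj[of x] S_closed by auto
qed (simp add: S_in_X)

text \<open>
  The two words of a braid relation meet the same classes, in opposite order. At \<open>l = 0\<close> the braid
  relation gives an equality in \<open>G\<close>: the last reflection of \<open>y x y \<dots>\<close> is \<open>x\<close>. The induction step
  conjugates by \<open>x\<close>, which turns the reflection in place \<open>l\<close> of \<open>y x y \<dots>\<close> into the one in place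
  \<open>l + 1\<close> of \<open>x y x \<dots>\<close> and, because \<open>x \<otimes> x\<close> acts trivially on classes, leads from place \<open>j + 1\<close> of
  \<open>x y x \<dots>\<close> back to place \<open>j\<close> of \<open>y x y \<dots>\<close>.
\<close>

lemma dihedral_reflection_palindrome:
  assumes "x \<in> S" "y \<in> S" "alternating G x y k = alternating G y x k" "l < k"
  shows "dihedral_reflection G x y l \<approx> dihedral_reflection G y x (k - Suc l)"
  using assms
proof (induction l arbitrary: x y)
  case 0
  then obtain k' where k: "k = Suc k'" by (cases k) auto
  have c: "x \<in> carrier G" "y \<in> carrier G" using 0 S_closed by auto
  have "dihedral_reflection G y x k' \<otimes> alternating G y x k' = x \<otimes> alternating G y x k'"
    using dihedral_reflection_alternating[OF c(2,1), of k'] 0(3) by (simp add: k)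
  then have "dihedral_reflection G y x k' = x"
    using c dihedral_reflection_closed alternating_closed by simp
  then show ?case using 0 by (simp add: k invol_refl S_in_X)
next
  case (Suc l)
  let ?r = "dihedral_reflection G y x (k - Suc (Suc l))"
  have x: "x \<in> carrier G" "x \<in> X" using Suc.prems S_closed S_in_X by auto
  have r: "?r \<in> X" using Suc.prems by (intro dihedral_reflection_X)
  have "dihedral_reflection G y x l \<approx> dihedral_reflection G x y (k - Suc l)"
    using Suc.prems by (intro Suc.IH) auto
  then have "dihedral_reflection G x y (Suc l)
      \<approx> x \<otimes> dihedral_reflection G x y (k - Suc l) \<otimes> inv x"
    using invol_conj[OF x(1)] by simp
  also have "k - Suc l = Suc (k - Suc (Suc l))"
    using Suc.prems by simp
  also have "x \<otimes> dihedral_reflection G x y (Suc (k - Suc (Suc l))) \<otimes> inv x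
      = (x \<otimes> x) \<otimes> ?r \<otimes> inv (x \<otimes> x)"
    using x r by (simp add: conj_conj)
  also have "\<dots> \<approx> ?r"
    using r x(2) by (rule invol_square)
  finally show ?case .
qed

definition marked_gen :: "'a \<Rightarrow> 'a \<times> ('a \<Rightarrow> bit)" where
  "marked_gen s = (s, \<lambda>x. of_bool (x \<approx> s))"

lemma marked_gen_closed: "s \<in> S \<Longrightarrow> marked_gen s \<in> carrier (bit_semidirect G)"
  using S_closed X_closed invol_cong_X by (auto simp: marked_gen_def bit_semidirect_def)

lemma alternating_marked_gen:
  assumes "x \<in> S" "y \<in> S"
  shows "alternating (bit_semidirect G) (marked_gen x) (marked_gen y) k =
    (alternating G x y k, \<lambda>z. \<Sum>l<k. of_bool (z \<approx> dihedral_reflection G x y l))"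
  using assms
proof (induction k arbitrary: x y)
  case (Suc k)
  have x: "x \<in> carrier G" using Suc.prems S_closed by auto
  have "of_bool (z \<approx> x) + conj_translate G x
      (\<lambda>z. \<Sum>l<k. of_bool (z \<approx> dihedral_reflection G y x l)) z
    = (\<Sum>l<Suc k. of_bool (z \<approx> dihedral_reflection G x y l))" (is "?L z = ?R z") for z
  proof (cases "z \<in> X")
    case True
    then have "inv x \<otimes> z \<otimes> x \<approx> dihedral_reflection G y x l \<longleftrightarrow>
        z \<approx> dihedral_reflection G x y (Suc l)" for l
      using invol_conj_iff[OF x True dihedral_reflection_X[OF Suc.prems(2,1)]] by simp
    then show ?thesis
      using True by (simp add: conj_translate_def sum.lessThan_Suc_shift del: sum.lessThan_Suc)
  next
    case False
    have "\<not> inv x \<otimes> z \<otimes> x \<approx> w" if "z \<in> carrier G" for w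
    proof
      assume "inv x \<otimes> z \<otimes> x \<approx> w"
      then have "x \<otimes> (inv x \<otimes> z \<otimes> x) \<otimes> inv x \<in> X"
        using X_conj[OF x] invol_cong_X by blast
      then show False using False that x by (simp add: conj_inverse_cancel)
    qed
    moreover have "\<not> z \<approx> w" for w
      using False invol_cong_X by blast
    ultimately show ?thesis
      by (simp add: conj_translate_def)
  qed
  then show ?case
    using Suc by (simp add: bit_semidirect_def marked_gen_def)
qed (simp add: bit_semidirect_def)

text \<open>
  The marked generators satisfy the braid relations of the generators: the second component of
  either side counts the classes met along the word, and the order of counting is immaterial.
\<close>

lemma alternating_marked_gen_commute:
  assumes "x \<in> S" "y \<in> S" "alternating G x y k = alternating G y x k"
  shows "alternating (bit_semidirect G) (marked_gen x) (marked_gen y) k =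
    alternating (bit_semidirect G) (marked_gen y) (marked_gen x) k"
proof -
  have "(\<Sum>l<k. of_bool (z \<approx> dihedral_reflection G x y l)) =
      (\<Sum>l<k. of_bool (z \<approx> dihedral_reflection G y x l) :: bit)" for z
  proof -
    have "(\<Sum>l<k. of_bool (z \<approx> dihedral_reflection G x y l)) =
        (\<Sum>l<k. of_bool (z \<approx> dihedral_reflection G y x (k - Suc l)) :: bit)"
    proof (rule sum.cong)
      fix l assume "l \<in> {..<k}"
      then have "z \<approx> dihedral_reflection G x y l \<longleftrightarrow> z \<approx> dihedral_reflection G y x (k - Suc l)"
        using dihedral_reflection_palindrome[OF assms, of l] invol_trans invol_sym by blast
      then show "of_bool (z \<approx> dihedral_reflection G x y l) =
          (of_bool (z \<approx> dihedral_reflection G y x (k - Suc l)) :: bit)" by simp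
    qed simp
    also have "\<dots> = (\<Sum>l<k. of_bool (z \<approx> dihedral_reflection G y x l))"
      by (rule sum.nat_diff_reindex)
    finally show ?thesis .
  qed
  then show ?thesis
    using assms by (simp add: alternating_marked_gen)
qed

end

section \<open>Artin groups\<close>

lemma artin_relations_closed:
  "artin_relations n m \<subseteq> carrier (free_group {1..n}) \<times> carrier (free_group {1..n})"
proof -
  have "alternating (free_group {1..n}) (free_gen {1..n} i) (free_gen {1..n} j) k
      \<in> carrier (free_group {1..n})" if "i \<in> {1..n}" "j \<in> {1..n}" for i j k
    using that by (intro group.alternating_closed group_free_group free_gen_closed)
  then show ?thesis
    unfolding artin_relations_def by blast
qed

lemma artin_relation_holds:
  assumes "has_presentation A {1..n} s (artin_relations n m)"
    and "i \<in> {1..n}" "j \<in> {1..n}" "i \<noteq> j" "m i j = enat k"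
  shows "alternating A (s i) (s j) k = alternating A (s j) (s i) k"
proof -
  have A: "group A" using assms(1) by (simp add: has_presentation_def)
  obtain \<theta> where \<theta>: "\<theta> \<in> hom (free_group {1..n}) A"
    "\<And>i. i \<in> {1..n} \<Longrightarrow> \<theta> (free_gen {1..n} i) = s i"
    "\<And>u v. (u, v) \<in> artin_relations n m \<Longrightarrow> \<theta> u = \<theta> v"
    using has_presentation_hom[OF assms(1) artin_relations_closed] by metis
  have "\<theta> (alternating (free_group {1..n}) (free_gen {1..n} i) (free_gen {1..n} j) k)
      = \<theta> (alternating (free_group {1..n}) (free_gen {1..n} j) (free_gen {1..n} i) k)"
    using assms(2-) by (intro \<theta>(3)) (auto simp: artin_relations_def)
  then show ?thesis
    using alternating_hom[OF group_free_group A \<theta>(1)] assms(2,3) free_gen_closed \<theta>(2) by metis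
qed

text \<open>
  Von Dyck's theorem sends each generator to the pair of itself and the indicator function of its
  class; \<open>c g\<close> is the second component of the image of \<open>g\<close>.
\<close>

lemma artin_reflection_cocycle:
  assumes "1 \<le> n" "artin_group A n m s"
  obtains c where "reflection_cocycle A (s ` {1..n}) c"
proof -
  have pres: "has_presentation A {1..n} s (artin_relations n m)"
    using assms(2) by (simp add: artin_group_def)
  note gen = has_presentation_generate[OF pres artin_relations_closed]
  interpret dehn_group A "s ` {1..n}"
    using pres gen(2) assms(1)
    by (auto simp: dehn_group_def dehn_group_axioms_def has_presentation_def)
  have marked: "(\<lambda>i. marked_gen (s i)) \<in> {1..n} \<rightarrow> carrier (bit_semidirect A)"
    by (intro Pi_I marked_gen_closed imageI)
  have rel: "\<psi> u = \<psi> v"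
    if \<psi>: "\<psi> \<in> hom (free_group {1..n}) (bit_semidirect A)"
      "\<And>i. i \<in> {1..n} \<Longrightarrow> \<psi> (free_gen {1..n} i) = marked_gen (s i)"
      and uv: "(u, v) \<in> artin_relations n m" for \<psi> u v
  proof -
    obtain i j k where ij: "i \<in> {1..n}" "j \<in> {1..n}" "i \<noteq> j" "m i j = enat k"
      and u: "u = alternating (free_group {1..n}) (free_gen {1..n} i) (free_gen {1..n} j) k"
      and v: "v = alternating (free_group {1..n}) (free_gen {1..n} j) (free_gen {1..n} i) k"
      using uv unfolding artin_relations_def by blast
    note hom = alternating_hom[OF group_free_group group_bit_semidirect \<psi>(1)]
    show ?thesis
      unfolding u v hom[OF free_gen_closed[OF ij(1)] free_gen_closed[OF ij(2)]]
        hom[OF free_gen_closed[OF ij(2)] free_gen_closed[OF ij(1)]] \<psi>(2)[OF ij(1)] \<psi>(2)[OF ij(2)]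
      using artin_relation_holds[OF pres ij] ij(1,2)
      by (intro alternating_marked_gen_commute) auto
  qed
  obtain f where f: "f \<in> hom A (bit_semidirect A)"
    "\<And>i. i \<in> {1..n} \<Longrightarrow> f (s i) = marked_gen (s i)"
    using von_Dyck[OF pres artin_relations_closed group_bit_semidirect marked rel] by metis
  interpret f: group_hom A "bit_semidirect A" f
    using f(1) by (simp add: group_hom_def group_hom_axioms_def group_bit_semidirect)
  have f_gen: "f t = (t, \<lambda>x. of_bool (invol_cong x t))" if "t \<in> s ` {1..n}" for t
    using that f(2) unfolding marked_gen_def by blast
  \<comment> \<open>\<open>f\<close> is a section of the projection, as the endomorphism \<open>fst \<circ> f\<close> fixes all generators.\<close>
  have fst_f: "fst (f g) = g" if "g \<in> carrier A" for g
  proof -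
    have fst: "fst \<in> hom (bit_semidirect A) A"
      by (auto simp: hom_def bit_semidirect_def)
    interpret ff: group_hom A A "fst \<circ> f"
      by unfold_locales (rule Group.hom_compose[OF f(1) fst])
    have "g \<in> generate A (s ` {1..n})" using that gen(1) by simp
    then have "g \<in> carrier A \<and> (fst \<circ> f) g = g"
    proof (induction rule: generate.induct)
      case one
      then show ?case using ff.hom_one by simp
    next
      case (incl h)
      then show ?case using f_gen[OF incl] S_closed by auto
    next
      case (inv h)
      then have "h \<in> carrier A" "(fst \<circ> f) h = h"
        using f_gen[OF inv] S_closed by auto
      then show ?case using ff.hom_inv[of h] by simp
    next
      case (eng g h)
      then show ?case using ff.hom_mult[of g h] by simp
    qed
    then show ?thesis by simp
  qed
  show thesis
  proof
    show "reflection_cocycle A (s ` {1..n}) (\<lambda>g. snd (f g))"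
    proof
      show "carrier A = generate A (s ` {1..n})" by (fact gen(1))
      show "snd (f (g \<otimes>\<^bsub>A\<^esub> h)) x = snd (f g) x + snd (f h) (inv\<^bsub>A\<^esub> g \<otimes>\<^bsub>A\<^esub> x \<otimes>\<^bsub>A\<^esub> g)"
        if "g \<in> carrier A" "h \<in> carrier A" "x \<in> carrier A" for g h x
        using that f.hom_mult[of g h] fst_f[of g] by (simp add: bit_semidirect_def conj_translate_def)
      show "snd (f t) x = of_bool (invol_cong x t)" if "t \<in> s ` {1..n}" for t x
        using f_gen[OF that] by simp
    qed
  qed
qed

theorem theorem4p3:
  fixes A :: "('a, 'm) monoid_scheme"
    and n :: nat
    and m :: "nat \<Rightarrow> nat \<Rightarrow> enat"
    and s :: "nat \<Rightarrow> 'a"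
  assumes "1 \<le> n"
    and "artin_group A n m s"
  shows "quandle_isomorphic
           (involutory_quandle (dehn_quandle A (s ` {1..n})))
           (dehn_quandle (coxeter_group A n s) (coxeter_gen A n s ` {1..n}))"
proof -
  obtain c where "reflection_cocycle A (s ` {1..n}) c"
    using artin_reflection_cocycle[OF assms] .
  then interpret reflection_cocycle A "s ` {1..n}" c .
  let ?W = "coxeter_group A n s"
  let ?\<pi> = "group_quot_proj A (coxeter_relations A n s)"
  let ?P = "dehn_quandle A (s ` {1..n})"
  let ?Q = "dehn_quandle ?W (coxeter_gen A n s ` {1..n})"
  have R: "coxeter_relations A n s \<subseteq> carrier A \<times> carrier A"
    unfolding coxeter_relations_def using S_closed by fastforce
  note q = group_quot_proj_hom[OF R, folded coxeter_group_def]
  interpret \<pi>: group_hom A ?W ?\<pi>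
    using q(1,2) by (simp add: group_hom_def group_hom_axioms_def)
  have gens: "coxeter_gen A n s ` {1..n} = ?\<pi> ` (s ` {1..n})"
    by (auto simp: coxeter_gen_def)
  have gens_closed: "coxeter_gen A n s ` {1..n} \<subseteq> carrier ?W"
    unfolding gens using S_closed \<pi>.hom_closed by blast
  have Q: "quandle ?Q"
    using gens_closed assms(1) by (intro \<pi>.H.quandle_dehn_quandle) auto
  have \<pi>_conj: "?\<pi> (g \<otimes>\<^bsub>A\<^esub> x \<otimes>\<^bsub>A\<^esub> inv\<^bsub>A\<^esub> g) = ?\<pi> g \<otimes>\<^bsub>?W\<^esub> ?\<pi> x \<otimes>\<^bsub>?W\<^esub> inv\<^bsub>?W\<^esub> ?\<pi> g"
    if "g \<in> carrier A" "x \<in> carrier A" for g x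
    using that by simp
  have surj: "?\<pi> ` X = carrier ?Q"
  proof
    show "?\<pi> ` X \<subseteq> carrier ?Q"
    proof
      fix y assume "y \<in> ?\<pi> ` X"
      then obtain g t where g: "g \<in> carrier A" and t: "t \<in> s ` {1..n}"
        and y: "y = ?\<pi> (g \<otimes>\<^bsub>A\<^esub> t \<otimes>\<^bsub>A\<^esub> inv\<^bsub>A\<^esub> g)"
        by (auto elim!: dehn_quandleE)
      have "y = ?\<pi> g \<otimes>\<^bsub>?W\<^esub> ?\<pi> t \<otimes>\<^bsub>?W\<^esub> inv\<^bsub>?W\<^esub> ?\<pi> g"
        using g t y S_closed \<pi>_conj by blast
      moreover have "?\<pi> t \<in> carrier ?Q"
        using t gens by (intro \<pi>.H.dehn_quandle_base[OF gens_closed]) auto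
      ultimately show "y \<in> carrier ?Q"
        using \<pi>.H.dehn_quandle_conj[OF gens_closed \<pi>.hom_closed[OF g]] by simp
    qed
    show "carrier ?Q \<subseteq> ?\<pi> ` X"
    proof
      fix y assume "y \<in> carrier ?Q"
      then obtain w u where w: "w \<in> carrier ?W" and u: "u \<in> coxeter_gen A n s ` {1..n}"
        and y: "y = w \<otimes>\<^bsub>?W\<^esub> u \<otimes>\<^bsub>?W\<^esub> inv\<^bsub>?W\<^esub> w"
        by (rule dehn_quandleE)
      obtain t where t: "t \<in> s ` {1..n}" "u = ?\<pi> t"
        using u unfolding gens by blast
      obtain g where g: "g \<in> carrier A" "w = ?\<pi> g"
        using w q(3) by blast
      then have "y = ?\<pi> (g \<otimes>\<^bsub>A\<^esub> t \<otimes>\<^bsub>A\<^esub> inv\<^bsub>A\<^esub> g)"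
        using y t S_closed \<pi>_conj by blast
      then show "y \<in> ?\<pi> ` X"
        using X_conj[OF g(1) S_in_X[OF t(1)]] by blast
    qed
  qed
  have hom: "?\<pi> \<in> quandle_hom ?P ?Q"
    using surj \<pi>_conj by (auto simp: quandle_hom_def)
  let ?R = "{((x \<star>\<^bsub>?P\<^esub> y) \<star>\<^bsub>?P\<^esub> y, x) | x y. x \<in> X \<and> y \<in> X}"
  have square: "?\<pi> y \<otimes>\<^bsub>?W\<^esub> ?\<pi> y = \<one>\<^bsub>?W\<^esub>" if y: "y \<in> X" for y
  proof -
    obtain g t where g: "g \<in> carrier A" "t \<in> s ` {1..n}" "y = g \<otimes>\<^bsub>A\<^esub> t \<otimes>\<^bsub>A\<^esub> inv\<^bsub>A\<^esub> g"
      using y by (rule dehn_quandleE)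
    then have t: "t \<in> carrier A" using S_closed by blast
    have "?\<pi> (t \<otimes>\<^bsub>A\<^esub> t) = ?\<pi> \<one>\<^bsub>A\<^esub>"
      using g(2) by (intro q(4)) (auto simp: coxeter_relations_def)
    moreover have "y \<otimes>\<^bsub>A\<^esub> y = g \<otimes>\<^bsub>A\<^esub> (t \<otimes>\<^bsub>A\<^esub> t) \<otimes>\<^bsub>A\<^esub> inv\<^bsub>A\<^esub> g"
      using conj_mult[OF g(1) t t] g(3) by simp
    ultimately have "?\<pi> (y \<otimes>\<^bsub>A\<^esub> y) = \<one>\<^bsub>?W\<^esub>"
      using \<pi>_conj[of g "t \<otimes>\<^bsub>A\<^esub> t"] g(1) t by simp
    then show ?thesis using y by simp
  qed
  have ker: "?\<pi> x = ?\<pi> y \<longleftrightarrow> (x, y) \<in> quandle_cong ?P ?R" if xy: "x \<in> X" "y \<in> X" for x y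
  proof
    assume "(x, y) \<in> quandle_cong ?P ?R"
    then show "?\<pi> x = ?\<pi> y"
    proof (rule quandle_cong_kernel[OF D.quandle_axioms Q hom, rotated])
      fix x y assume "(x, y) \<in> ?R"
      then obtain z where z: "z \<in> X" "y \<in> X" "x = (z \<otimes>\<^bsub>A\<^esub> z) \<otimes>\<^bsub>A\<^esub> y \<otimes>\<^bsub>A\<^esub> inv\<^bsub>A\<^esub> (z \<otimes>\<^bsub>A\<^esub> z)"
        by (auto simp: conj_conj)
      then show "?\<pi> x = ?\<pi> y"
        using \<pi>_conj[of "z \<otimes>\<^bsub>A\<^esub> z" y] square[OF z(1)] by simp
    qed
  next
    assume eq: "?\<pi> x = ?\<pi> y"
    have N: "rel_normal A (coxeter_relations A n s) = square_closure"
    proof -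
      have "{u \<otimes>\<^bsub>A\<^esub> inv\<^bsub>A\<^esub> v | u v. (u, v) \<in> coxeter_relations A n s}
          = {t \<otimes>\<^bsub>A\<^esub> t | t. t \<in> s ` {1..n}}"
        using S_closed by (force simp: coxeter_relations_def)
      then show ?thesis
        by (simp only: rel_normal_def square_closure_def)
    qed
    have "x \<otimes>\<^bsub>A\<^esub> inv\<^bsub>A\<^esub> y \<in> square_closure"
    proof -
      have sub: "subgroup square_closure A"
        by (rule normal_imp_subgroup[OF normal_square_closure])
      have "x \<in> square_closure #>\<^bsub>A\<^esub> y"
        using eq rcos_self[OF X_closed[OF xy(1)] sub] by (simp add: group_quot_proj_def N)
      then show ?thesis
        using subgroup.rcos_module_imp[OF sub is_group] xy by simp
    qed
    from invol_cong_if_coset_eq[OF xy this] show "(x, y) \<in> quandle_cong ?P ?R"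
      by (simp only: invol_cong_def)
  qed
  show ?thesis
    unfolding involutory_quandle_def
    by (rule quandle_quot_isomorphic[OF D.quandle_axioms Q hom surj ker])
qed

end
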